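(* Let $\alpha\ge1$ and $\Lambda,\lambda,y_0>0$. Let $g:(0,\infty)\to\mathbb R$ be of class $\mathcal C^2$, and assume that $g$ is defined and $\mathcal C^1$ in a neighborhood of $0$ in $[0,\infty)$, that $|g'(y)|\ge\lambda$ for any $y\in[0,y_0]$ and that $|g''(y)|\ge\lambda y^{\alpha}$ for any $y\in(0,y_0]$. If $\alpha=1$, assume also that $\lambda y^{\alpha+1}\le|g'(y)-g'(0)|\le\Lambda y^{\alpha+1}$ for any $y\in[0,y_0]$. Let $\chi$ be a smooth function on $[0,\infty)$ such that $\chi(y)=0$ for any $y\ge y_0$. Then there exists $C>0$ such that for any $t\in\mathbb R\setminus\{0\}$ and any $\delta>0$, $$\sup_{x\in\mathbb R^2}\Big|\int_{\mathbb R^2}e^{ix\cdot\xi}e^{i\frac t\delta g(\delta|\xi|)}\chi(\delta|\xi|)\,d\xi\Big|\le C\,\frac{\delta^{-\frac32\frac{1+\alpha}{2+\alpha}}}{|t|^{\frac{5+\alpha}{2(2+\alpha)}}}.$$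
   Context: Dimension $n=2$. The constant $C$ does not depend on $t,\delta,x$. *)

theory Defs
  imports "HOL-Analysis.Analysis"
begin

(* D k is the k-th derivative of f on S; end points of an interval S get one-sided derivatives. *)
definition smooth_on :: "real set \<Rightarrow> (real \<Rightarrow> 'a::real_normed_vector) \<Rightarrow> bool" where
  "smooth_on S f \<longleftrightarrow>
     (\<exists>D. D 0 = f \<and>
       (\<forall>k::nat. \<forall>y\<in>S. (D k has_vector_derivative D (Suc k) y) (at y within S)))"

definition osc_integral ::
  "(real \<Rightarrow> real) \<Rightarrow> (real \<Rightarrow> complex) \<Rightarrow> real \<Rightarrow> real \<Rightarrow> real ^ 2 \<Rightarrow> complex" where
  "osc_integral g chi t \<delta> x =
     (LINT \<xi>|lborel. exp (\<i> * of_real (x \<bullet> \<xi>))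
        * exp (\<i> * of_real (t / \<delta> * g (\<delta> * norm \<xi>))) * chi (\<delta> * norm \<xi>))"

end

theory Submission
  imports Defs
begin

text \<open>After rescaling, with \<open>\<tau> = t / \<delta>\<close> and \<open>K = norm x / \<delta>\<close>, averaging over rotations turns the integral into
  \<open>\<integral> r chi(r) e^{i \<tau> g(r)} B(K r) dr\<close> over \<open>[0, y\<^sub>0]\<close>, where \<open>B(s)\<close> is the integral of \<open>e^{i s cos \<theta>}\<close> over the circle.
  If \<open>K \<le> lam \<bar>\<tau>\<bar> / 2\<close>, the radial phase is nonstationary for every \<open>\<theta>\<close> and one integration by parts gives
  \<open>O(1 / \<bar>\<tau>\<bar>)\<close>. Otherwise \<open>B(s) = s^{-1/2} (e^{i s} P(s) + e^{-i s} Q(s))\<close> with amplitudes \<open>P, Q\<close> of symbol type,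
  which leaves a phase with \<open>\<bar>\<phi>''(r)\<bar> \<ge> lam \<bar>\<tau>\<bar> r^\<alpha>\<close> and an amplitude of size \<open>K^{-1/2} r^{1/2}\<close>. The trivial
  bound is used below the scale \<open>\<rho> = \<bar>\<tau>\<bar>^{-1/(2+\<alpha>)}\<close>; above it, the interval is split around the point \<open>r0\<close> where
  \<open>\<bar>\<phi>'\<bar>\<close> is minimal, with second-derivative bounds for \<open>r\<close> comparable to \<open>r0\<close> and integration by parts for
  \<open>r \<le> r0 / 2\<close> and \<open>r \<ge> 2 r0\<close>. Every piece is \<open>O(\<rho>^{3/2} \<bar>\<tau>\<bar>^{-1/2})\<close>, which is the claimed rate.\<close>

subsection \<open>Oscillatory integrals on an interval\<close>

lemma has_vector_derivative_cis:
  assumes "(f has_real_derivative d) (at x within S)"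
  shows "((\<lambda>r. exp (\<i> * of_real (f r))) has_vector_derivative exp (\<i> * of_real (f x)) * (\<i> * of_real d))
           (at x within S)"
proof -
  have "((\<lambda>r. \<i> * complex_of_real (f r)) has_vector_derivative \<i> * of_real d) (at x within S)"
    using assms by (intro has_vector_derivative_mult_right has_vector_derivative_of_real)
      (simp add: has_real_derivative_iff_has_vector_derivative)
  from field_vector_diff_chain_within[OF this, of exp "exp (\<i> * of_real (f x))"]
  show ?thesis by (simp add: o_def mult.commute DERIV_exp has_field_derivative_at_within)
qed

text \<open>Integration by parts, phrased as a comparison of increments: the error term
  \<open>R\<close> is dominated pointwise by the derivative of an explicit \<open>k\<close>, so no
  integral of \<open>f''\<close> or \<open>A'\<close> ever appears. The fixed sign of
  \<open>f''\<close> is what lets the term with |f''| / f'^2 be written as part of an exact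
  derivative.\<close>

lemma oscillatory_integral_by_parts:
  fixes f f' f'' w w' V V' :: "real \<Rightarrow> real" and A A' :: "real \<Rightarrow> complex"
  assumes ab: "a \<le> b"
    and cont: "continuous_on {a..b} f" "continuous_on {a..b} f'" "continuous_on {a..b} A"
      "continuous_on {a..b} w" "continuous_on {a..b} V"
    and f: "\<And>r. a < r \<Longrightarrow> r < b \<Longrightarrow> (f has_real_derivative f' r) (at r)"
    and f': "\<And>r. a < r \<Longrightarrow> r < b \<Longrightarrow> (f' has_real_derivative f'' r) (at r)"
    and nz: "\<And>r. a \<le> r \<Longrightarrow> r \<le> b \<Longrightarrow> f' r \<noteq> 0"
    and s: "s = 1 \<or> s = -1" "\<And>r. a < r \<Longrightarrow> r < b \<Longrightarrow> 0 \<le> s * f'' r"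
    and A: "\<And>r. a < r \<Longrightarrow> r < b \<Longrightarrow> (A has_vector_derivative A' r) (at r)"
    and w: "\<And>r. a < r \<Longrightarrow> r < b \<Longrightarrow> (w has_real_derivative w' r) (at r)"
    and V: "\<And>r. a < r \<Longrightarrow> r < b \<Longrightarrow> (V has_real_derivative V' r) (at r)"
    and Aw: "\<And>r. a \<le> r \<Longrightarrow> r \<le> b \<Longrightarrow> cmod (A r) \<le> w r"
    and Aw': "\<And>r. a < r \<Longrightarrow> r < b \<Longrightarrow> cmod (A' r) \<le> w' r"
    and Vw: "\<And>r. a < r \<Longrightarrow> r < b \<Longrightarrow> w' r \<le> V' r * \<bar>f' r\<bar>"
  shows "cmod (integral {a..b} (\<lambda>r. exp (\<i> * of_real (f r)) * A r))
           \<le> 2 * (w a / \<bar>f' a\<bar> + w b / \<bar>f' b\<bar>) + 2 * (V b - V a)"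
proof (cases "a = b")
  case True
  have "0 \<le> w a" using Aw[of a] ab norm_ge_zero order_trans by blast
  then show ?thesis using True by simp
next
  case False
  with ab have ab': "a < b" by simp
  define E where "E r = exp (\<i> * of_real (f r))" for r
  have cE: "continuous_on {a..b} E"
    unfolding E_def by (intro continuous_intros cont)
  have nE: "cmod (E r) = 1" for r by (simp add: E_def)
  have dE: "(E has_vector_derivative E r * (\<i> * of_real (f' r))) (at r)" if "a < r" "r < b" for r
    unfolding E_def by (rule has_vector_derivative_cis[OF f[OF that]])
  define G where "G r = E r * A r * of_real (1 / f' r)" for r
  \<comment> \<open>The derivative of \<open>G\<close> is \<open>R\<close> plus the main term
    \<open>\<i> * (E r * A r)\<close>. Subtracting the indefinite integral removes the main term, so
    \<open>H\<close> has derivative \<open>R\<close>.\<close>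
  define H where "H r = G r - \<i> * integral {a..r} (\<lambda>r. E r * A r)" for r
  \<comment> \<open>Differentiating \<open>- s * w / f'\<close> produces
    \<open>s * w * f'' / f'^2\<close>, the curvature part of the bound on \<open>R\<close>. The
    doubled \<open>V\<close> pays for \<open>w' / |f'|\<close> itself and for the leftover term
    \<open>- s * w' / f'\<close>, whose sign is not known.\<close>
  define k where "k r = 2 * V r - s * (w r * (1 / f' r))" for r
  define k' where "k' r = 2 * V' r - s * (w' r * (1 / f' r) + w r * (- f'' r / (f' r)\<^sup>2))" for r
  define R where "R r = E r * (A' r * of_real (1 / f' r) + A r * of_real (- f'' r / (f' r)\<^sup>2))" for r
  have cEA: "continuous_on {a..b} (\<lambda>r. E r * A r)" by (intro continuous_intros cE cont)
  have cG: "continuous_on {a..b} G" unfolding G_def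
    by (intro continuous_intros cE cont) (use nz in auto)
  have cH: "continuous_on {a..b} H" unfolding H_def
    by (intro continuous_intros cG indefinite_integral_continuous_1 integrable_continuous_real cEA)
  have ck: "continuous_on {a..b} k" unfolding k_def
    by (intro continuous_intros cont) (use nz in auto)
  have dinv: "((\<lambda>r. 1 / f' r) has_real_derivative (- f'' r / (f' r)\<^sup>2)) (at r)" if "a < r" "r < b" for r
    using nz[of r] that by (auto intro!: derivative_eq_intros f'[OF that] simp: power2_eq_square)
  have dk: "(k has_vector_derivative k' r) (at r)" if "a < r" "r < b" for r
    unfolding k_def k'_def has_real_derivative_iff_has_vector_derivative[symmetric]
    by (rule derivative_eq_intros V[OF that] w[OF that] dinv[OF that] refl)+ (simp add: algebra_simps)
  have dH: "(H has_vector_derivative R r) (at r)" if r: "a < r" "r < b" for r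
  proof -
    have I: "((\<lambda>u. integral {a..u} (\<lambda>r. E r * A r)) has_vector_derivative E r * A r) (at r)"
      using integral_has_vector_derivative[OF cEA, of r] r
      by (simp add: at_within_Icc_at)
    have inv: "((\<lambda>r. complex_of_real (1 / f' r)) has_vector_derivative of_real (- f'' r / (f' r)\<^sup>2)) (at r)"
      by (rule has_vector_derivative_of_real)
         (use dinv[OF r] in \<open>simp add: has_real_derivative_iff_has_vector_derivative\<close>)
    have "(H has_vector_derivative
       ((E r * A r) * of_real (- f'' r / (f' r)\<^sup>2) + (E r * A' r + (E r * (\<i> * of_real (f' r))) * A r) * of_real (1 / f' r))
         - \<i> * (E r * A r)) (at r)"
      unfolding H_def G_def
      by (intro has_vector_derivative_diff has_vector_derivative_mult inv dE A r
           has_vector_derivative_mult_right I)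
    also have "((E r * A r) * of_real (- f'' r / (f' r)\<^sup>2) + (E r * A' r + (E r * (\<i> * of_real (f' r))) * A r) * of_real (1 / f' r))
         - \<i> * (E r * A r) = R r"
      using nz[of r] r by (simp add: R_def field_simps)
    finally show ?thesis .
  qed
  have RH: "cmod (R r) \<le> k' r" if r: "a < r" "r < b" for r
  proof -
    have nzr: "f' r \<noteq> 0" using nz r by auto
    have w0: "0 \<le> w r" using Aw[of r] r norm_ge_zero order_trans by (metis less_imp_le)
    have w0': "0 \<le> w' r" using Aw'[of r] r norm_ge_zero order_trans by blast
    have wV: "w' r / \<bar>f' r\<bar> \<le> V' r"
      using Vw[OF r] nzr by (simp add: field_simps)
    have "cmod (R r) = cmod (A' r * of_real (1 / f' r) + A r * of_real (- f'' r / (f' r)\<^sup>2))"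
      by (simp only: R_def norm_mult nE mult_1)
    also have "\<dots> \<le> cmod (A' r * of_real (1 / f' r)) + cmod (A r * of_real (- f'' r / (f' r)\<^sup>2))"
      by (rule norm_triangle_ineq)
    also have "\<dots> = cmod (A' r) / \<bar>f' r\<bar> + cmod (A r) * (\<bar>f'' r\<bar> / (f' r)\<^sup>2)"
      unfolding norm_mult norm_of_real by simp
    also have "\<dots> \<le> w' r / \<bar>f' r\<bar> + w r * (\<bar>f'' r\<bar> / (f' r)\<^sup>2)"
      using r by (intro add_mono divide_right_mono mult_right_mono Aw Aw') auto
    also have "\<bar>f'' r\<bar> = s * f'' r"
      using s(1) s(2)[OF r] by auto
    also have "w' r / \<bar>f' r\<bar> + w r * (s * f'' r / (f' r)\<^sup>2) \<le> k' r"
    proof -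
      have "s * (w' r * (1 / f' r)) \<le> w' r / \<bar>f' r\<bar>"
      proof -
        have "s * (w' r * (1 / f' r)) \<le> \<bar>s * (w' r * (1 / f' r))\<bar>" by (rule abs_ge_self)
        also have "\<dots> = w' r / \<bar>f' r\<bar>" using s(1) w0' by (auto simp: abs_mult)
        finally show ?thesis .
      qed
      then have "w' r / \<bar>f' r\<bar> + s * (w' r * (1 / f' r)) \<le> 2 * V' r"
        using wV by linarith
      then show ?thesis by (simp add: k'_def algebra_simps)
    qed
    finally show ?thesis .
  qed
  have "cmod (H b - H a) \<le> k b - k a"
    by (rule differentiable_bound_general[OF ab' cH ck dH dk RH])
  moreover have "H b - H a = G b - G a - \<i> * integral {a..b} (\<lambda>r. E r * A r)"
    by (simp add: H_def)
  ultimately have 1: "cmod (G b - G a - \<i> * integral {a..b} (\<lambda>r. E r * A r)) \<le> k b - k a" by simp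
  have Gb: "cmod (G r) \<le> w r / \<bar>f' r\<bar>" if "a \<le> r" "r \<le> b" for r
    unfolding G_def norm_mult nE norm_of_real using Aw[OF that] by (simp add: divide_right_mono)
  have kb: "\<bar>s * (w r * (1 / f' r))\<bar> \<le> w r / \<bar>f' r\<bar>" if "a \<le> r" "r \<le> b" for r
    using s(1) order_trans[OF norm_ge_zero Aw[OF that]] by (auto simp: abs_mult)
  have "cmod (integral {a..b} (\<lambda>r. E r * A r)) = cmod (\<i> * integral {a..b} (\<lambda>r. E r * A r))"
    by (simp add: norm_mult)
  also have "\<dots> \<le> cmod (G b - G a - \<i> * integral {a..b} (\<lambda>r. E r * A r)) + cmod (G b) + cmod (G a)"
    by (smt (verit) norm_triangle_ineq4 norm_triangle_sub norm_minus_commute)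
  also have "\<dots> \<le> k b - k a + w b / \<bar>f' b\<bar> + w a / \<bar>f' a\<bar>"
    using 1 Gb[of a] Gb[of b] ab by linarith
  also have "\<dots> \<le> 2 * (w a / \<bar>f' a\<bar> + w b / \<bar>f' b\<bar>) + 2 * (V b - V a)"
    using abs_le_D1[OF kb[of a]] abs_le_D2[OF kb[of b]] ab unfolding k_def by (auto simp: ring_distribs)
  finally show ?thesis by (simp add: E_def)
qed


text \<open>With \<open>V = w / m\<close> the increment of \<open>V\<close> cancels the boundary
  contribution at \<open>a\<close>, and four copies of \<open>w b / m\<close> remain.\<close>

corollary nonstationary_phase:
  fixes f f' f'' w w' :: "real \<Rightarrow> real" and A A' :: "real \<Rightarrow> complex"
  assumes ab: "a \<le> b"
    and cont: "continuous_on {a..b} f" "continuous_on {a..b} f'" "continuous_on {a..b} A"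
      "continuous_on {a..b} w"
    and f: "\<And>r. a < r \<Longrightarrow> r < b \<Longrightarrow> (f has_real_derivative f' r) (at r)"
    and f': "\<And>r. a < r \<Longrightarrow> r < b \<Longrightarrow> (f' has_real_derivative f'' r) (at r)"
    and m: "0 < m" "\<And>r. a \<le> r \<Longrightarrow> r \<le> b \<Longrightarrow> m \<le> \<bar>f' r\<bar>"
    and s: "s = 1 \<or> s = -1" "\<And>r. a < r \<Longrightarrow> r < b \<Longrightarrow> 0 \<le> s * f'' r"
    and A: "\<And>r. a < r \<Longrightarrow> r < b \<Longrightarrow> (A has_vector_derivative A' r) (at r)"
    and w: "\<And>r. a < r \<Longrightarrow> r < b \<Longrightarrow> (w has_real_derivative w' r) (at r)"
    and Aw: "\<And>r. a \<le> r \<Longrightarrow> r \<le> b \<Longrightarrow> cmod (A r) \<le> w r"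
    and Aw': "\<And>r. a < r \<Longrightarrow> r < b \<Longrightarrow> cmod (A' r) \<le> w' r"
  shows "cmod (integral {a..b} (\<lambda>r. exp (\<i> * of_real (f r)) * A r)) \<le> 4 * w b / m"
proof -
  have w0: "0 \<le> w r" if "a \<le> r" "r \<le> b" for r
    using Aw[OF that] norm_ge_zero order_trans by blast
  have wm: "w r / \<bar>f' r\<bar> \<le> w r / m" if "a \<le> r" "r \<le> b" for r
    using w0[OF that] m(1) m(2)[OF that] by (intro divide_left_mono) auto
  have "cmod (integral {a..b} (\<lambda>r. exp (\<i> * of_real (f r)) * A r))
      \<le> 2 * (w a / \<bar>f' a\<bar> + w b / \<bar>f' b\<bar>) + 2 * (w b / m - w a / m)"
  proof (rule oscillatory_integral_by_parts[OF ab cont(1-4) _ f f' _ s A w _ Aw Aw'])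
    show "continuous_on {a..b} (\<lambda>r. w r / m)" by (intro continuous_intros cont) (use m in auto)
    show "((\<lambda>r. w r / m) has_real_derivative w' r / m) (at r)" if "a < r" "r < b" for r
      by (rule DERIV_cdivide[OF w[OF that]])
    show "w' r \<le> w' r / m * \<bar>f' r\<bar>" if r: "a < r" "r < b" for r
    proof -
      have "0 \<le> w' r" using Aw'[OF r] norm_ge_zero order_trans by blast
      then have "w' r * m \<le> w' r * \<bar>f' r\<bar>" using m(2)[of r] r by (intro mult_left_mono) auto
      then show ?thesis using m(1) by (simp add: field_simps)
    qed
    show "f' r \<noteq> 0" if "a \<le> r" "r \<le> b" for r using m(2)[OF that] m(1) by auto
  qed auto
  also have "\<dots> \<le> 4 * w b / m" using wm[of a] wm[of b] ab by simp
  finally show ?thesis .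
qed

section \<open>Phases whose curvature may degenerate like a power at the origin\<close>

lemma sqrt_divide_powr:
  fixes x :: real
  assumes "0 < x"
  shows "sqrt x / x powr (\<alpha> + 1) = x powr (- \<alpha> - 1 / 2)"
proof -
  have "x powr (- \<alpha> - 1 / 2) = x powr (1 / 2 - (\<alpha> + 1))" by (simp add: algebra_simps)
  then show ?thesis using assms by (simp only: powr_diff powr_half_sqrt)
qed

text \<open>A van der Corput argument with curvature at least \<open>L * r powr \<alpha>\<close>.
  The three summands of the constant come, in order, from \<open>r\<close> below
  \<open>r0 / 2\<close>, from \<open>r\<close> above \<open>2 * r0\<close>, and from
  \<open>r\<close> comparable to the minimizer \<open>r0\<close> of |f'|. The relation between
  \<open>L\<close>, \<open>\<rho>\<close> and \<open>\<kappa>\<close> turns each contribution into a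
  multiple of \<open>\<rho> powr (3 / 2)\<close>.\<close>

lemma degenerate_phase_estimate:
  fixes f f' f'' :: "real \<Rightarrow> real" and A A' :: "real \<Rightarrow> complex"
  assumes \<alpha>: "1 \<le> \<alpha>" and \<rho>: "0 < \<rho>" "\<rho> \<le> b" and L: "0 < L" "L * \<rho> powr (\<alpha> + 2) = \<kappa>"
    and cont: "continuous_on {\<rho>..b} f" "continuous_on {\<rho>..b} f'" "continuous_on {\<rho>..b} A"
    and f: "\<And>r. \<rho> < r \<Longrightarrow> r < b \<Longrightarrow> (f has_real_derivative f' r) (at r)"
    and f': "\<And>r. \<rho> < r \<Longrightarrow> r < b \<Longrightarrow> (f' has_real_derivative f'' r) (at r)"
    and s: "s = 1 \<or> s = -1" "\<And>r. \<rho> < r \<Longrightarrow> r < b \<Longrightarrow> L * r powr \<alpha> \<le> s * f'' r"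
    and A: "\<And>r. \<rho> < r \<Longrightarrow> r < b \<Longrightarrow> (A has_vector_derivative A' r) (at r)"
    and Aw: "\<And>r. \<rho> \<le> r \<Longrightarrow> r \<le> b \<Longrightarrow> cmod (A r) \<le> N * sqrt r"
    and Aw': "\<And>r. \<rho> < r \<Longrightarrow> r < b \<Longrightarrow> cmod (A' r) \<le> N / (2 * sqrt r)"
  shows "cmod (integral {\<rho>..b} (\<lambda>r. exp (\<i> * of_real (f r)) * A r))
           \<le> (8 / \<kappa> + 6 * 2 powr (\<alpha> + 2) / \<kappa> + 36 * 2 powr ((\<alpha> - 1) / 2) / sqrt \<kappa>) * N * \<rho> powr (3 / 2)"
proof -
  define F where "F r = exp (\<i> * of_real (f r)) * A r" for r
  have cF: "continuous_on {\<rho>..b} F" unfolding F_def by (intro continuous_intros cont)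
  have iF: "F integrable_on {u..v}" if "\<rho> \<le> u" "v \<le> b" for u v
    by (rule integrable_continuous_real, rule continuous_on_subset[OF cF]) (use that in auto)
  have N: "0 \<le> N"
    using order_trans[OF norm_ge_zero Aw[of \<rho>]] \<rho> by (simp add: zero_le_mult_iff)
  have \<kappa>: "0 < \<kappa>" using L \<rho> by (metis mult_pos_pos powr_gt_zero less_numeral_extra(3))
  have spos: "0 \<le> s * f'' r" if "\<rho> < r" "r < b" for r
    using s(2)[OF that] L(1) by (smt (verit) mult_nonneg_nonneg powr_ge_zero)
  \<comment> \<open>Mean value theorem, with the curvature on the interval bounded below by its
    bound at the left end \<open>u\<close>.\<close>
  have grow: "L * u powr \<alpha> * (v - u) \<le> s * f' v - s * f' u" if uv: "\<rho> \<le> u" "u \<le> v" "v \<le> b" for u v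
  proof (cases "u = v")
    case False
    with uv have "u < v" by simp
    have "\<exists>l z. u < z \<and> z < v \<and> ((\<lambda>r. s * f' r) has_real_derivative l) (at z) \<and> s * f' v - s * f' u = (v - u) * l"
    proof (rule MVT[OF \<open>u < v\<close>])
      show "continuous_on {u..v} (\<lambda>r. s * f' r)"
        by (intro continuous_intros continuous_on_subset[OF cont(2)]) (use uv in auto)
      show "(\<lambda>r. s * f' r) differentiable at x" if "u < x" "x < v" for x
        using f'[of x] that uv
        by (auto intro!: derivative_intros simp: real_differentiable_def)
    qed
    then obtain l z where z: "u < z" "z < v" "((\<lambda>r. s * f' r) has_real_derivative l) (at z)"
      "s * f' v - s * f' u = (v - u) * l" by blast
    have "l = s * f'' z"
      using DERIV_unique[OF z(3) DERIV_cmult[OF f', of z s]] z uv by simp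
    moreover have "L * u powr \<alpha> \<le> L * z powr \<alpha>"
      using z uv \<rho> \<alpha> L by (intro mult_left_mono powr_mono2) auto
    ultimately have "L * u powr \<alpha> \<le> l" using s(2)[of z] z uv by simp
    then show ?thesis using z(4) \<open>u < v\<close> by (simp add: mult.commute mult_left_mono)
  qed simp
  have mono: "s * f' u \<le> s * f' v" if uv: "\<rho> \<le> u" "u \<le> v" "v \<le> b" for u v
    using grow[OF that] that L by (smt (verit) mult_nonneg_nonneg powr_ge_zero)
  \<comment> \<open>The minimizer replaces the stationary point: \<open>f'\<close> may have no zero
    in the interval, but |f'| always attains its minimum.\<close>
  obtain r0 where r0: "\<rho> \<le> r0" "r0 \<le> b" "\<And>r. \<rho> \<le> r \<Longrightarrow> r \<le> b \<Longrightarrow> \<bar>f' r0\<bar> \<le> \<bar>f' r\<bar>"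
    using continuous_attains_inf[of "{\<rho>..b}" "\<lambda>r. \<bar>f' r\<bar>"] cont(2) \<rho>
    by (force intro: continuous_on_rabs)
  \<comment> \<open>From |f' r0| \<le> |f' r| the triangle inequality gives |f' r - f' r0| \<le> 2
    |f' r|. Growth of \<open>f'\<close> away from \<open>r0\<close> thus bounds |f'| from below,
    whether or not \<open>f' r0\<close> vanishes.\<close>
  have far: "\<bar>s * f' r - s * f' r0\<bar> / 2 \<le> \<bar>f' r\<bar>" if "\<rho> \<le> r" "r \<le> b" for r
    using r0(3)[OF that] s(1) by auto
  define c where "c = r0 / 2"
  have c: "\<rho> / 2 \<le> c" "0 < c" "r0 = 2 * c" using r0 \<rho> by (auto simp: c_def)
  have piece: "cmod (integral {u..v} F) \<le> 4 * (N * sqrt v) / m"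
    if uv: "\<rho> \<le> u" "u \<le> v" "v \<le> b" and m: "0 < m" "\<And>r. u \<le> r \<Longrightarrow> r \<le> v \<Longrightarrow> m \<le> \<bar>f' r\<bar>" for u v m
    unfolding F_def
  proof (rule nonstationary_phase[where s = s and f'' = f'' and A' = A' and w' = "\<lambda>r. N / (2 * sqrt r)" and w = "\<lambda>r. N * sqrt r" and f' = f'])
    show "continuous_on {u..v} f" "continuous_on {u..v} f'" "continuous_on {u..v} A"
      using uv by (auto intro: continuous_on_subset[OF cont(1)] continuous_on_subset[OF cont(2)] continuous_on_subset[OF cont(3)])
    show "((\<lambda>r. N * sqrt r) has_real_derivative N / (2 * sqrt r)) (at r)" if "u < r" "r < v" for r
      using that uv \<rho> by (auto intro!: derivative_eq_intros simp: field_simps)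
  qed (use uv m s spos f f' A Aw Aw' in \<open>auto intro!: continuous_intros\<close>)
  define P where "P = \<rho> powr (3 / 2)"
  define c1 where "c1 = max \<rho> c"
  \<comment> \<open>The scale with \<open>L * c powr \<alpha> * h * h = 1\<close>. It balances the
    trivial bound within distance \<open>h\<close> of \<open>r0\<close> against integration by parts
    farther away.\<close>
  define h where "h = 1 / sqrt (L * c powr \<alpha>)"
  have K: "0 < L * c powr \<alpha>" using L c by simp
  have h: "0 < h" using K by (simp add: h_def)
  \<comment> \<open>The cut points are clipped to the interval, so a piece that does not fit
    collapses to a point and contributes nothing.\<close>
  define e where "e = max c1 (r0 - h)"
  define d where "d = min b (2 * r0)"
  define g where "g = min d (r0 + h)"
  have ord: "\<rho> \<le> c1" "c1 \<le> e" "e \<le> g" "g \<le> d" "d \<le> b" "c1 \<le> r0" "e \<le> r0" "r0 \<le> g" "r0 \<le> d"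
    using r0 \<rho> c h by (auto simp: c1_def e_def d_def g_def)
  have Lrho: "N * (\<rho> powr (- \<alpha> - 1 / 2) / L) = N * P / \<kappa>"
  proof -
    have "\<rho> powr (- \<alpha> - 1 / 2) * \<rho> powr (\<alpha> + 2) = P"
      by (simp add: P_def flip: powr_add)
    then show ?thesis using L \<rho> by (simp add: field_simps flip: L(2))
  qed
  \<comment> \<open>For \<open>r \<le> c\<close> the increment of \<open>f'\<close> over the
    interval from \<open>c\<close> to \<open>r0\<close>, of length \<open>c\<close>, already yields
    |f' r| \<ge> \<open>L * c powr \<alpha> * c / 2\<close>.\<close>
  have I1: "cmod (integral {\<rho>..c1} F) \<le> 8 / \<kappa> * N * P"
  proof (cases "\<rho> \<le> c")
    case True
    then have [simp]: "c1 = c" by (simp add: c1_def)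
    have "cmod (integral {\<rho>..c1} F) \<le> 4 * (N * sqrt c) / (L * c powr \<alpha> * c / 2)"
      unfolding \<open>c1 = c\<close>
    proof (rule piece)
      show "0 < L * c powr \<alpha> * c / 2" using K c by simp
      fix r assume r: "\<rho> \<le> r" "r \<le> c"
      have "L * c powr \<alpha> * c \<le> s * f' r0 - s * f' c" using grow[of c r0] True c r0 by simp
      also have "\<dots> \<le> s * f' r0 - s * f' r" using mono[of r c] r True c r0 by simp
      finally show "L * c powr \<alpha> * c / 2 \<le> \<bar>f' r\<bar>" using far[of r] r c r0 by simp
    qed (use True c r0 in auto)
    also have "\<dots> = 8 * (N * (c powr (- \<alpha> - 1 / 2) / L))"
    proof -
      have "c powr (- \<alpha> - 1 / 2) = sqrt c / (c powr \<alpha> * c)"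
        using sqrt_divide_powr[of c \<alpha>] c by (simp add: powr_add)
      then show ?thesis by simp
    qed
    also have "\<dots> \<le> 8 * (N * (\<rho> powr (- \<alpha> - 1 / 2) / L))"
      using True \<rho> L N \<alpha> by (intro mult_left_mono divide_right_mono powr_mono2') auto
    also have "\<dots> = 8 / \<kappa> * N * P" unfolding Lrho by simp
    finally show ?thesis .
  next
    case False
    then show ?thesis using N \<kappa> by (simp add: c1_def P_def)
  qed
  have I5: "cmod (integral {d..b} F) \<le> 6 * 2 powr (\<alpha> + 2) / \<kappa> * N * P"
  proof (cases "2 * r0 \<le> b")
    case True
    then have d: "d = 2 * r0" by (simp add: d_def)
    \<comment> \<open>The power of 2 collects three losses in comparing \<open>r\<close> with
      \<open>r / 2 \<ge> r0\<close>: \<open>2 powr \<alpha>\<close> from the curvature at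
      \<open>r / 2\<close>, a factor 2 from the length \<open>r / 2\<close>, and a factor 2 from
      \<open>far\<close>.\<close>
    define M where "M = L / 2 powr (\<alpha> + 2)"
    have M: "0 < M" using L by (simp add: M_def)
    have fM: "M * r powr (\<alpha> + 1) \<le> \<bar>f' r\<bar>" if r: "d \<le> r" "r \<le> b" for r
    proof -
      have "L * (r / 2) powr \<alpha> * (r - r / 2) \<le> s * f' r - s * f' (r / 2)"
        by (rule grow) (use r d r0 \<rho> in auto)
      also have "\<dots> \<le> s * f' r - s * f' r0" using mono[of r0 "r/2"] r d r0 \<rho> by simp
      finally have "L * (r / 2) powr \<alpha> * (r / 2) / 2 \<le> \<bar>f' r\<bar>" using far[of r] r d r0 \<rho> by simp
      moreover have "L * (r / 2) powr \<alpha> * (r / 2) / 2 = M * r powr (\<alpha> + 1)"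
        using r d r0 \<rho> by (simp add: M_def powr_divide powr_add)
      ultimately show ?thesis by simp
    qed
    have wf: "N * sqrt r / \<bar>f' r\<bar> \<le> N / M * \<rho> powr (- \<alpha> - 1 / 2)" if r: "d \<le> r" "r \<le> b" for r
    proof -
      have r': "0 < r" "\<rho> \<le> r" using r d r0 \<rho> by auto
      have "N * sqrt r / \<bar>f' r\<bar> \<le> N * sqrt r / (M * r powr (\<alpha> + 1))"
      proof (rule divide_left_mono)
        have "0 < M * r powr (\<alpha> + 1)" using M r' by simp
        then show "0 < \<bar>f' r\<bar> * (M * r powr (\<alpha> + 1))" using fM[OF r] by (smt (verit) mult_pos_pos)
      qed (use fM[OF r] N r' in auto)
      also have "\<dots> = N / M * r powr (- \<alpha> - 1 / 2)"
        using r' by (simp flip: sqrt_divide_powr)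
      also have "\<dots> \<le> N / M * \<rho> powr (- \<alpha> - 1 / 2)"
        using r' \<rho> M N \<alpha> by (intro mult_left_mono divide_right_mono powr_mono2') auto
      finally show ?thesis .
    qed
    \<comment> \<open>A uniform lower bound for |f'| would leave a factor \<open>sqrt b\<close>.
      This majorant exploits the growth of |f'| like \<open>r powr (\<alpha> + 1)\<close>, and its
      increment is controlled by the value at the left end \<open>d\<close> alone.\<close>
    define V where "V r = - (N / M * r powr (- \<alpha> - 1 / 2))" for r
    have "cmod (integral {d..b} F) \<le> 2 * (N * sqrt d / \<bar>f' d\<bar> + N * sqrt b / \<bar>f' b\<bar>) + 2 * (V b - V d)"
      unfolding F_def
    proof (rule oscillatory_integral_by_parts[where s = s and f'' = f'' and A' = A' and w' = "\<lambda>r. N / (2 * sqrt r)" 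
          and w = "\<lambda>r. N * sqrt r" and f' = f' and V' = "\<lambda>r. N / M * (\<alpha> + 1 / 2) * r powr (- \<alpha> - 3 / 2)"])
      have d0: "\<rho> \<le> d" using ord by simp
      show "continuous_on {d..b} f" "continuous_on {d..b} f'" "continuous_on {d..b} A"
        using d0 by (auto intro: continuous_on_subset[OF cont(1)] continuous_on_subset[OF cont(2)] continuous_on_subset[OF cont(3)])
      show "continuous_on {d..b} V" unfolding V_def
        by (intro continuous_intros) (use d0 \<rho> in auto)
      show "((\<lambda>r. N * sqrt r) has_real_derivative N / (2 * sqrt r)) (at r)" if "d < r" "r < b" for r
        using that d0 \<rho> by (auto intro!: derivative_eq_intros simp: field_simps)
      show "(V has_real_derivative N / M * (\<alpha> + 1 / 2) * r powr (- \<alpha> - 3 / 2)) (at r)" if "d < r" "r < b" for r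
      proof -
        have "0 < r" using that d0 \<rho> by auto
        have "(V has_real_derivative - (N / M * ((- \<alpha> - 1 / 2) * r powr (- \<alpha> - 1 / 2 - 1)))) (at r)"
          unfolding V_def by (intro DERIV_minus DERIV_cmult has_real_derivative_powr \<open>0 < r\<close>)
        moreover have "- \<alpha> - 1 / 2 - 1 = - \<alpha> - 3 / (2::real)" by simp
        ultimately show ?thesis by (simp add: algebra_simps)
      qed
      show "f' r \<noteq> 0" if "d \<le> r" "r \<le> b" for r
        using fM[OF that] M that d0 \<rho>
        by (smt (verit) mult_pos_pos powr_gt_zero)
      show "N / (2 * sqrt r) \<le> N / M * (\<alpha> + 1 / 2) * r powr (- \<alpha> - 3 / 2) * \<bar>f' r\<bar>" if r: "d < r" "r < b" for r
      proof -
        have r': "0 < r" using r d0 \<rho> by auto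
        have "N / (2 * sqrt r) = N * (1 / 2) * r powr (- 1 / 2)"
          using r' by (simp add: powr_minus powr_half_sqrt field_simps)
        also have "\<dots> \<le> N * (\<alpha> + 1 / 2) * r powr (- 1 / 2)"
          using N \<alpha> by (intro mult_right_mono mult_left_mono) auto
        also have "\<dots> = N / M * (\<alpha> + 1 / 2) * r powr (- \<alpha> - 3 / 2) * (M * r powr (\<alpha> + 1))"
        proof -
          have "r powr (- \<alpha> - 3 / 2) * r powr (\<alpha> + 1) = r powr (- 1 / 2)" by (simp flip: powr_add)
          then show ?thesis using M by simp
        qed
        also have "\<dots> \<le> N / M * (\<alpha> + 1 / 2) * r powr (- \<alpha> - 3 / 2) * \<bar>f' r\<bar>"
          using fM[of r] r N M \<alpha> by (intro mult_left_mono) auto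
        finally show ?thesis .
      qed
    qed (use ord s spos f f' A Aw Aw' in \<open>auto intro!: continuous_intros\<close>)
    \<comment> \<open>Two boundary terms and the increment of \<open>V\<close> are each at most the
      same quantity, and each carries a factor 2.\<close>
    also have "\<dots> \<le> 6 * (N / M * \<rho> powr (- \<alpha> - 1 / 2))"
    proof -
      have "V b \<le> 0" using N M by (simp add: V_def)
      moreover have "- V d \<le> N / M * \<rho> powr (- \<alpha> - 1 / 2)"
        using ord \<rho> M N \<alpha> by (auto simp: V_def intro!: mult_left_mono divide_right_mono powr_mono2')
      ultimately show ?thesis using wf[of d] wf[of b] ord by simp
    qed
    also have "\<dots> = 6 * 2 powr (\<alpha> + 2) * (N * (\<rho> powr (- \<alpha> - 1 / 2) / L))"
      by (simp add: M_def)
    also have "\<dots> = 6 * 2 powr (\<alpha> + 2) / \<kappa> * N * P" unfolding Lrho by simp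
    finally show ?thesis by simp
  next
    case False
    then show ?thesis using N \<kappa> by (simp add: d_def P_def)
  qed
  define Q where "Q = N * sqrt (2 * r0)"
  have Q: "0 \<le> Q" using N r0 \<rho> by (simp add: Q_def)
  have sQ: "N * sqrt v \<le> Q" if "v \<le> d" for v
    unfolding Q_def using N that by (intro mult_left_mono) (auto simp: d_def)
  have up: "L * c powr \<alpha> * (v - u) \<le> s * f' v - s * f' u" if "c1 \<le> u" "u \<le> v" "v \<le> b" for u v
  proof -
    have "L * c powr \<alpha> * (v - u) \<le> L * u powr \<alpha> * (v - u)"
      using that c \<alpha> L by (intro mult_right_mono mult_left_mono powr_mono2) (auto simp: c1_def)
    then show ?thesis using grow[of u v] that by (simp add: c1_def)
  qed
  \<comment> \<open>At distance at least \<open>h\<close> from \<open>r0\<close> the lower bound is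
    |f'| \<ge> \<open>L * c powr \<alpha> * h / 2\<close>. By the choice of \<open>h\<close>,
    dividing \<open>Q\<close> by \<open>L * c powr \<alpha> * h\<close> is the same as multiplying
    it by \<open>h\<close>.\<close>
  have side: "cmod (integral {u..v} F) \<le> 8 * (Q * h)"
    if uv: "c1 \<le> u" "u \<le> v" "v \<le> d" and away: "\<And>r. u \<le> r \<Longrightarrow> r \<le> v \<Longrightarrow> h \<le> \<bar>r - r0\<bar>" for u v
  proof -
    have "cmod (integral {u..v} F) \<le> 4 * (N * sqrt v) / (L * c powr \<alpha> * h / 2)"
    proof (rule piece)
      show "0 < L * c powr \<alpha> * h / 2" using K h by simp
      fix r assume r: "u \<le> r" "r \<le> v"
      have "L * c powr \<alpha> * h \<le> L * c powr \<alpha> * \<bar>r - r0\<bar>"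
        using away[OF r] K by (intro mult_left_mono) auto
      also have "\<dots> \<le> \<bar>s * f' r - s * f' r0\<bar>"
        using up[of r r0] up[of r0 r] r uv ord by (cases "r \<le> r0") auto
      finally show "L * c powr \<alpha> * h / 2 \<le> \<bar>f' r\<bar>" using far[of r] r uv ord by simp
    qed (use uv ord in auto)
    also have "\<dots> \<le> 4 * Q / (L * c powr \<alpha> * h / 2)"
      using sQ[OF uv(3)] K h by (intro divide_right_mono mult_left_mono) auto
    also have "\<dots> = 8 * (Q * h)"
    proof -
      have "L * c powr \<alpha> * h * h = 1"
        using K L c by (simp add: h_def)
      then have "1 / (L * c powr \<alpha> * h) = h" by (metis inverse_unique inverse_eq_divide)
      moreover have "4 * Q / (L * c powr \<alpha> * h / 2) = 8 * (Q * (1 / (L * c powr \<alpha> * h)))" by simp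
      ultimately show ?thesis by simp
    qed
    finally show ?thesis .
  qed
  have I2: "cmod (integral {c1..e} F) \<le> 8 * (Q * h)"
  proof (cases "c1 \<le> r0 - h")
    case True then show ?thesis using side[of c1 e] ord h by (auto simp: e_def)
  next
    case False then show ?thesis using Q h by (simp add: e_def)
  qed
  have I4: "cmod (integral {g..d} F) \<le> 8 * (Q * h)"
  proof (cases "r0 + h \<le> d")
    case True then show ?thesis using side[of g d] ord h by (auto simp: g_def)
  next
    case False then show ?thesis using Q h by (simp add: g_def)
  qed
  have I3: "cmod (integral {e..g} F) \<le> 2 * (Q * h)"
  proof -
    have "cmod (integral {e..g} F) \<le> Q * (g - e)"
    proof (rule integral_bound)
      show "continuous_on {e..g} F" by (rule continuous_on_subset[OF cF]) (use ord in auto)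
      fix r assume r: "r \<in> {e..g}"
      have "cmod (F r) = cmod (A r)" by (simp add: F_def norm_mult)
      also have "\<dots> \<le> N * sqrt r" using Aw r ord by auto
      also have "\<dots> \<le> Q" using sQ[of r] r ord by auto
      finally show "cmod (F r) \<le> Q" .
    qed (use ord in auto)
    also have "\<dots> \<le> Q * (2 * h)" using Q by (intro mult_left_mono) (auto simp: e_def g_def)
    finally show ?thesis by simp
  qed
  \<comment> \<open>This is where \<open>1 \<le> \<alpha>\<close> matters for the middle region: the
    exponent \<open>(1 - \<alpha>) / 2\<close> is not positive, so \<open>c \<ge> \<rho> / 2\<close>
    bounds this power of \<open>c\<close> from above. The remaining exponents of
    \<open>\<rho>\<close> add up to 3/2.\<close>
  have Qh: "Q * h \<le> 2 * 2 powr ((\<alpha> - 1) / 2) / sqrt \<kappa> * N * P"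
  proof -
    have "Q * h = N * 2 / sqrt L * c powr ((1 - \<alpha>) / 2)"
    proof -
      have "sqrt (2 * r0) = 2 * sqrt c" using c by (simp add: real_sqrt_mult)
      moreover have "h = 1 / (sqrt L * c powr (\<alpha> / 2))"
        using c by (simp add: h_def real_sqrt_mult powr_half_sqrt_powr)
      moreover have "c powr ((1 - \<alpha>) / 2) = sqrt c / c powr (\<alpha> / 2)"
        using c by (simp add: diff_divide_distrib powr_diff powr_half_sqrt)
      ultimately show ?thesis by (simp add: Q_def)
    qed
    also have "\<dots> \<le> N * 2 / sqrt L * (\<rho> / 2) powr ((1 - \<alpha>) / 2)"
      using c \<rho> N L \<alpha> by (intro mult_left_mono powr_mono2') auto
    also have "(\<rho> / 2) powr ((1 - \<alpha>) / 2) = \<rho> powr ((1 - \<alpha>) / 2) * 2 powr ((\<alpha> - 1) / 2)"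
    proof -
      have "(1 - \<alpha>) / 2 = - ((\<alpha> - 1) / 2)" by (simp add: field_simps)
      then have "2 powr ((1 - \<alpha>) / 2) = 1 / 2 powr ((\<alpha> - 1) / 2)" by (metis powr_minus_divide)
      then show ?thesis using \<rho> by (simp add: powr_divide)
    qed
    also have "sqrt L = sqrt \<kappa> / \<rho> powr ((\<alpha> + 2) / 2)"
    proof -
      have "sqrt \<kappa> = sqrt L * sqrt (\<rho> powr (\<alpha> + 2))" by (simp add: real_sqrt_mult flip: L(2))
      also have "sqrt (\<rho> powr (\<alpha> + 2)) = \<rho> powr ((\<alpha> + 2) / 2)"
        using \<rho> by (simp add: powr_half_sqrt_powr)
      finally show ?thesis using \<rho> by simp
    qed
    also have "N * 2 / (sqrt \<kappa> / \<rho> powr ((\<alpha> + 2) / 2)) * (\<rho> powr ((1 - \<alpha>) / 2) * 2 powr ((\<alpha> - 1) / 2))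
       = N * 2 / sqrt \<kappa> * 2 powr ((\<alpha> - 1) / 2) * (\<rho> powr ((\<alpha> + 2) / 2) * \<rho> powr ((1 - \<alpha>) / 2))"
      by simp
    also have "\<rho> powr ((\<alpha> + 2) / 2) * \<rho> powr ((1 - \<alpha>) / 2) = P"
    proof -
      have "(\<alpha> + 2) / 2 + (1 - \<alpha>) / 2 = 3 / 2" by (simp add: field_simps)
      then show ?thesis by (metis P_def powr_add)
    qed
    finally show ?thesis by (simp add: mult_ac)
  qed
  have "integral {\<rho>..b} F = integral {\<rho>..c1} F + integral {c1..e} F + integral {e..g} F + integral {g..d} F + integral {d..b} F"
  proof -
    have "integral {\<rho>..b} F = integral {\<rho>..d} F + integral {d..b} F"
      by (rule Henstock_Kurzweil_Integration.integral_combine[symmetric]) (use ord iF in auto)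
    also have "integral {\<rho>..d} F = integral {\<rho>..g} F + integral {g..d} F"
      by (rule Henstock_Kurzweil_Integration.integral_combine[symmetric]) (use ord iF in auto)
    also have "integral {\<rho>..g} F = integral {\<rho>..e} F + integral {e..g} F"
      by (rule Henstock_Kurzweil_Integration.integral_combine[symmetric]) (use ord iF in auto)
    also have "integral {\<rho>..e} F = integral {\<rho>..c1} F + integral {c1..e} F"
      by (rule Henstock_Kurzweil_Integration.integral_combine[symmetric]) (use ord iF in auto)
    finally show ?thesis .
  qed
  then have "cmod (integral {\<rho>..b} F) \<le> cmod (integral {\<rho>..c1} F) + cmod (integral {c1..e} F) +
      cmod (integral {e..g} F) + cmod (integral {g..d} F) + cmod (integral {d..b} F)"
    by (simp only:) (intro norm_triangle_le add_mono order_refl)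
  \<comment> \<open>The three pieces around \<open>r0\<close> cost 8 + 2 + 8 copies of
    \<open>Q * h\<close>; the factor 2 in \<open>Qh\<close> then gives the 36 of the
    statement.\<close>
  also have "\<dots> \<le> 8 / \<kappa> * N * P + 18 * (Q * h) + 6 * 2 powr (\<alpha> + 2) / \<kappa> * N * P"
    using I1 I2 I3 I4 I5 by linarith
  also have "\<dots> \<le> (8 / \<kappa> + 6 * 2 powr (\<alpha> + 2) / \<kappa> + 36 * 2 powr ((\<alpha> - 1) / 2) / sqrt \<kappa>) * N * P"
    using Qh by (simp add: distrib_right)
  finally show ?thesis by (simp add: F_def[abs_def] P_def)
qed

subsection \<open>The circle integral and its Bessel equation\<close>

text \<open>This is 2 pi times the Bessel function of the first kind of order 0.\<close>

definition circle_wave :: "real \<Rightarrow> complex" where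
  "circle_wave s = integral {0..2 * pi} (\<lambda>\<theta>. exp (\<i> * of_real (s * cos \<theta>)))"

definition circle_wave_deriv :: "real \<Rightarrow> complex" where
  "circle_wave_deriv s =
     integral {0..2 * pi} (\<lambda>\<theta>. exp (\<i> * of_real (s * cos \<theta>)) * (\<i> * of_real (cos \<theta>)))"

lemma norm_circle_wave_le: "cmod (circle_wave s) \<le> 2 * pi"
proof -
  have "cmod (circle_wave s) \<le> 1 * (2 * pi - 0)"
    unfolding circle_wave_def
    by (rule integral_bound) (auto intro!: continuous_intros)
  then show ?thesis by simp
qed

lemma has_vector_derivative_circle_wave:
  "(circle_wave has_vector_derivative circle_wave_deriv s) (at s)"
proof -
  have "((\<lambda>s. integral (cbox 0 (2 * pi)) (\<lambda>\<theta>. exp (\<i> * of_real (s * cos \<theta>)))) has_vector_derivative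
      integral (cbox 0 (2 * pi)) (\<lambda>\<theta>. exp (\<i> * of_real (s * cos \<theta>)) * (\<i> * of_real (cos \<theta>)))) (at s)"
    by (rule leibniz_rule_vector_derivative)
       (auto simp: split_beta intro!: continuous_intros integrable_continuous_real has_vector_derivative_cis
         derivative_eq_intros simp del: of_real_mult)
  then show ?thesis by (simp add: circle_wave_def[abs_def] circle_wave_deriv_def)
qed

lemma has_vector_derivative_circle_wave_deriv:
  "(circle_wave_deriv has_vector_derivative
      integral {0..2 * pi} (\<lambda>\<theta>. exp (\<i> * of_real (s * cos \<theta>)) * (\<i> * of_real (cos \<theta>)) * (\<i> * of_real (cos \<theta>)))) (at s)"
proof -
  have "((\<lambda>s. exp (\<i> * of_real (s * cos \<theta>)) * (\<i> * of_real (cos \<theta>))) has_vector_derivative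
     exp (\<i> * of_real (s * cos \<theta>)) * (\<i> * of_real (cos \<theta>)) * (\<i> * of_real (cos \<theta>))) (at s)" for s \<theta>
    by (intro has_vector_derivative_mult_left has_vector_derivative_cis)
       (auto intro!: derivative_eq_intros)
  then have "((\<lambda>s. integral (cbox 0 (2 * pi)) (\<lambda>\<theta>. exp (\<i> * of_real (s * cos \<theta>)) * (\<i> * of_real (cos \<theta>)))) has_vector_derivative
      integral (cbox 0 (2 * pi)) (\<lambda>\<theta>. exp (\<i> * of_real (s * cos \<theta>)) * (\<i> * of_real (cos \<theta>)) * (\<i> * of_real (cos \<theta>)))) (at s)"
    by (intro leibniz_rule_vector_derivative)
       (auto simp: split_beta intro!: continuous_intros integrable_continuous_real simp del: of_real_mult)
  then show ?thesis by (simp add: circle_wave_deriv_def[abs_def])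
qed

text \<open>Bessel's equation of order 0. Integrating the derivative of exp(i s cos \<theta>) sin
  \<theta> over a period shows that the first derivative is \<open>- s * S\<close>, where
  \<open>S\<close> carries the weight sin^2. Writing cos^2 as 1 - sin^2 in the second derivative
  gives \<open>S - circle_wave s\<close>.\<close>

lemma circle_wave_deriv2:
  assumes "s \<noteq> 0"
  shows "(circle_wave_deriv has_vector_derivative - circle_wave s - circle_wave_deriv s / of_real s) (at s)"
proof -
  let ?e = "\<lambda>\<theta>. exp (\<i> * complex_of_real (s * cos \<theta>))"
  define S where "S = integral {0..2 * pi} (\<lambda>\<theta>. ?e \<theta> * of_real ((sin \<theta>)\<^sup>2))"
  have "((\<lambda>\<theta>. ?e \<theta> * of_real (cos \<theta>) + (?e \<theta> * (\<i> * of_real (s * - sin \<theta>))) * of_real (sin \<theta>)) has_integral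
      (?e (2 * pi) * of_real (sin (2 * pi)) - ?e 0 * of_real (sin 0))) {0..2 * pi}"
  proof (rule fundamental_theorem_of_calculus)
    show "((\<lambda>\<theta>. ?e \<theta> * of_real (sin \<theta>)) has_vector_derivative
        ?e \<theta> * of_real (cos \<theta>) + (?e \<theta> * (\<i> * of_real (s * - sin \<theta>))) * of_real (sin \<theta>)) (at \<theta> within {0..2 * pi})" for \<theta>
      by (intro has_vector_derivative_mult has_vector_derivative_cis has_vector_derivative_of_real)
         (auto intro!: derivative_eq_intros simp flip: has_real_derivative_iff_has_vector_derivative)
  qed simp
  then have "integral {0..2 * pi} (\<lambda>\<theta>. ?e \<theta> * of_real (cos \<theta>) + (?e \<theta> * (\<i> * of_real (s * - sin \<theta>))) * of_real (sin \<theta>)) = 0"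
    by (simp add: integral_unique)
  also have "(\<lambda>\<theta>. ?e \<theta> * of_real (cos \<theta>) + (?e \<theta> * (\<i> * of_real (s * - sin \<theta>))) * of_real (sin \<theta>))
     = (\<lambda>\<theta>. (?e \<theta> * (\<i> * of_real (cos \<theta>))) * (- \<i>) + (?e \<theta> * of_real ((sin \<theta>)\<^sup>2)) * (- \<i> * s))"
    by (auto simp: algebra_simps power2_eq_square)
  also have "integral {0..2 * pi} \<dots> = circle_wave_deriv s * (- \<i>) + S * (- \<i> * s)"
    unfolding circle_wave_deriv_def S_def
    by (subst integral_add) (auto intro!: continuous_intros integrable_continuous_real)
  finally have "- \<i> * (circle_wave_deriv s + of_real s * S) = 0"
    by (simp add: algebra_simps)
  then have S: "circle_wave_deriv s = - (of_real s * S)"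
    by (simp add: eq_neg_iff_add_eq_0)
  have "integral {0..2 * pi} (\<lambda>\<theta>. ?e \<theta> * (\<i> * of_real (cos \<theta>)) * (\<i> * of_real (cos \<theta>)))
     = integral {0..2 * pi} (\<lambda>\<theta>. ?e \<theta> * of_real ((sin \<theta>)\<^sup>2) - ?e \<theta>)"
  proof -
    have "(\<lambda>\<theta>. ?e \<theta> * (\<i> * of_real (cos \<theta>)) * (\<i> * of_real (cos \<theta>))) = (\<lambda>\<theta>. ?e \<theta> * of_real ((sin \<theta>)\<^sup>2) - ?e \<theta>)"
    proof
      fix \<theta>
      have "complex_of_real ((sin \<theta>)\<^sup>2) = 1 - of_real (cos \<theta>) * of_real (cos \<theta>)"
        unfolding sin_squared_eq by (simp add: power2_eq_square)
      then show "?e \<theta> * (\<i> * of_real (cos \<theta>)) * (\<i> * of_real (cos \<theta>)) = ?e \<theta> * of_real ((sin \<theta>)\<^sup>2) - ?e \<theta>"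
        by (simp only:) (simp add: algebra_simps)
    qed
    then show ?thesis by simp
  qed
  also have "\<dots> = S - circle_wave s"
    unfolding S_def circle_wave_def
    by (subst integral_diff) (auto intro!: continuous_intros integrable_continuous_real)
  also have "\<dots> = - circle_wave s - circle_wave_deriv s / of_real s"
    using S assms by simp
  finally show ?thesis
    using has_vector_derivative_circle_wave_deriv[of s] by simp
qed

text \<open>The function \<open>w s = sqrt s * circle_wave s\<close> satisfies \<open>w'' = - (1 + 1 / (4 s\<^sup>2)) w\<close>, so its
  energy \<open>\<bar>w'\<bar>\<^sup>2 + (1 + 1 / (4 s\<^sup>2)) \<bar>w\<bar>\<^sup>2\<close> decreases; this bounds \<open>w\<close> without any stationary phase argument.
  The amplitudes \<open>P\<close> come from writing \<open>w\<close> in the basis of solutions of the limit equation \<open>w'' = - w\<close>.\<close>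

lemma circle_wave_amplitudes:
  assumes s1: "0 < s1"
  obtains M P P' where "0 < M"
    "\<And>s. 0 < s \<Longrightarrow> cmod (circle_wave s) \<le> M / sqrt s"
    "\<And>s. 0 < s \<Longrightarrow> of_real (sqrt s) * circle_wave s
        = exp (\<i> * of_real s) * P (1::real) s + exp (- \<i> * of_real s) * P (-1) s"
    "\<And>\<epsilon> s. \<epsilon>\<^sup>2 = 1 \<Longrightarrow> 0 < s \<Longrightarrow> (P \<epsilon> has_vector_derivative P' \<epsilon> s) (at s)"
    "\<And>\<epsilon> s. \<epsilon>\<^sup>2 = 1 \<Longrightarrow> s1 \<le> s \<Longrightarrow> cmod (P \<epsilon> s) \<le> M"
    "\<And>\<epsilon> s. \<epsilon>\<^sup>2 = 1 \<Longrightarrow> s1 \<le> s \<Longrightarrow> cmod (P' \<epsilon> s) \<le> M / s"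
proof -
  define w where "w s = of_real (sqrt s) * circle_wave s" for s
  define w1 where "w1 s = of_real (sqrt s) * circle_wave_deriv s + of_real (1 / (2 * sqrt s)) * circle_wave s" for s
  have dsq: "((\<lambda>s. complex_of_real (sqrt s)) has_vector_derivative of_real (1 / (2 * sqrt s))) (at s)" if "0 < s" for s
    using that by (intro has_vector_derivative_of_real)
      (auto intro!: derivative_eq_intros simp: field_simps simp flip: has_real_derivative_iff_has_vector_derivative)
  have disq: "((\<lambda>s. complex_of_real (1 / (2 * sqrt s))) has_vector_derivative of_real (- 1 / (4 * s * sqrt s))) (at s)" if "0 < s" for s
    using that by (intro has_vector_derivative_of_real)
      (auto intro!: derivative_eq_intros simp: field_simps simp flip: has_real_derivative_iff_has_vector_derivative)
  have dw: "(w has_vector_derivative w1 s) (at s)" if "0 < s" for s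
    unfolding w_def w1_def using that
    by (intro has_vector_derivative_mult dsq has_vector_derivative_circle_wave)
  have dw1: "(w1 has_vector_derivative - (of_real (1 + 1 / (4 * s\<^sup>2)) * w s)) (at s)" if s: "0 < s" for s
  proof -
    have "(w1 has_vector_derivative (of_real (sqrt s) * (- circle_wave s - circle_wave_deriv s / of_real s)
           + of_real (1 / (2 * sqrt s)) * circle_wave_deriv s)
        + (of_real (1 / (2 * sqrt s)) * circle_wave_deriv s + of_real (- 1 / (4 * s * sqrt s)) * circle_wave s)) (at s)"
      unfolding w1_def using s
      by (intro has_vector_derivative_add has_vector_derivative_mult dsq disq has_vector_derivative_circle_wave circle_wave_deriv2) auto
    moreover have "(of_real (sqrt s) * (- circle_wave s - circle_wave_deriv s / of_real s)
           + of_real (1 / (2 * sqrt s)) * circle_wave_deriv s)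
        + (of_real (1 / (2 * sqrt s)) * circle_wave_deriv s + of_real (- 1 / (4 * s * sqrt s)) * circle_wave s)
        = - (of_real (1 + 1 / (4 * s\<^sup>2)) * w s)"
    proof -
      define q where "q = sqrt s"
      have q: "0 < q" "s = q\<^sup>2" using s by (auto simp: q_def)
      show ?thesis using q(1) unfolding w_def q_def[symmetric] q(2)
        by (simp add: real_sqrt_pow2 power2_eq_square field_simps)
    qed
    ultimately show ?thesis by simp
  qed
  define E where "E s = w1 s \<bullet> w1 s + (1 + 1 / (4 * s\<^sup>2)) * (w s \<bullet> w s)" for s
  \<comment> \<open>The cross terms of \<open>w\<close> and \<open>w1\<close> cancel by the
    differential equation; only the derivative of the coefficient 1 / (4 s^2) survives, and it is
    negative.\<close>
  have dE: "(E has_real_derivative - (1 / (2 * s ^ 3)) * (w s \<bullet> w s)) (at s)" if s: "0 < s" for s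
  proof -
    have "((\<lambda>s. w1 s \<bullet> w1 s) has_vector_derivative
        w1 s \<bullet> (- (of_real (1 + 1 / (4 * s\<^sup>2)) * w s)) + (- (of_real (1 + 1 / (4 * s\<^sup>2)) * w s)) \<bullet> w1 s) (at s)"
      by (rule bounded_bilinear.has_vector_derivative[OF bounded_bilinear_inner dw1[OF s] dw1[OF s]])
    moreover have "((\<lambda>s. w s \<bullet> w s) has_vector_derivative w s \<bullet> w1 s + w1 s \<bullet> w s) (at s)"
      by (rule bounded_bilinear.has_vector_derivative[OF bounded_bilinear_inner dw[OF s] dw[OF s]])
    moreover have "((\<lambda>s. 1 + 1 / (4 * s\<^sup>2)) has_real_derivative - 1 / (2 * s ^ 3)) (at s)"
      using s by (auto intro!: derivative_eq_intros simp: field_simps power2_eq_square power3_eq_cube)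
    ultimately have "(E has_real_derivative
        (w1 s \<bullet> (- (of_real (1 + 1 / (4 * s\<^sup>2)) * w s)) + (- (of_real (1 + 1 / (4 * s\<^sup>2)) * w s)) \<bullet> w1 s)
        + ((- 1 / (2 * s ^ 3)) * (w s \<bullet> w s) + (w s \<bullet> w1 s + w1 s \<bullet> w s) * (1 + 1 / (4 * s\<^sup>2)))) (at s)"
      unfolding E_def[abs_def] has_real_derivative_iff_has_vector_derivative[symmetric]
      by (intro DERIV_add DERIV_mult)
    moreover have w1w: "w1 s \<bullet> (of_real c * w s) = c * (w1 s \<bullet> w s)" for c
      by (simp flip: scaleR_conv_of_real)
    have "w1 s \<bullet> (- (of_real (1 + 1 / (4 * s\<^sup>2)) * w s)) + (- (of_real (1 + 1 / (4 * s\<^sup>2)) * w s)) \<bullet> w1 s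
        + ((- 1 / (2 * s ^ 3)) * (w s \<bullet> w s) + (w s \<bullet> w1 s + w1 s \<bullet> w s) * (1 + 1 / (4 * s\<^sup>2)))
      = - (1 / (2 * s ^ 3)) * (w s \<bullet> w s)"
      unfolding inner_minus_left inner_minus_right inner_commute[of _ "w1 s"] w1w by (simp add: algebra_simps)
    ultimately show ?thesis by (simp only:)
  qed
  define M0 where "M0 = sqrt (E s1)"
  have E_le: "E s \<le> E s1" if "s1 \<le> s" for s
  proof (rule DERIV_nonpos_imp_nonincreasing[OF that])
    fix x assume "s1 \<le> x" "x \<le> s"
    then have "0 < x" using s1 by simp
    then show "\<exists>y. (E has_real_derivative y) (at x) \<and> y \<le> 0"
      using dE by (intro exI[of _ "- (1 / (2 * x ^ 3)) * (w x \<bullet> w x)"]) (auto simp: mult_nonneg_nonneg)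
  qed
  have w_le: "cmod (w s) \<le> M0" "cmod (w1 s) \<le> M0" if "s1 \<le> s" for s
  proof -
    have "(1 + 1 / (4 * s\<^sup>2)) * (w s \<bullet> w s) = w s \<bullet> w s + 1 / (4 * s\<^sup>2) * (w s \<bullet> w s)"
      by (simp add: algebra_simps)
    moreover have "0 \<le> 1 / (4 * s\<^sup>2) * (w s \<bullet> w s)" by (intro mult_nonneg_nonneg) auto
    ultimately have "w s \<bullet> w s \<le> E s1" "w1 s \<bullet> w1 s \<le> E s1"
      using E_le[OF that] inner_ge_zero[of "w s"] inner_ge_zero[of "w1 s"] unfolding E_def[of s] by linarith+
    then show "cmod (w s) \<le> M0" "cmod (w1 s) \<le> M0"
      by (auto simp: M0_def norm_eq_sqrt_inner)
  qed
  have M0: "0 \<le> M0" using w_le[of s1] norm_ge_zero order_trans by blast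
  \<comment> \<open>Variation of constants: \<open>P 1\<close> and \<open>P (-1)\<close> are the
    coordinates of the pair \<open>w\<close>, \<open>w1\<close> with respect to exp(i s) and exp(-i
    s). Since \<open>\<epsilon>\<close> squares to 1, differentiation cancels the limit equation and
    leaves only the perturbation 1 / (4 s^2).\<close>
  define P where "P \<epsilon> s = exp (\<i> * of_real (- \<epsilon> * s)) * ((w s - \<i> * of_real \<epsilon> * w1 s) / 2)" for \<epsilon> s :: real
  define P' where "P' \<epsilon> s = exp (\<i> * of_real (- \<epsilon> * s)) * (\<i> * of_real \<epsilon> * w s / of_real (8 * s\<^sup>2))" for \<epsilon> s :: real
  have dP: "(P \<epsilon> has_vector_derivative P' \<epsilon> s) (at s)" if \<epsilon>: "\<epsilon>\<^sup>2 = 1" and s: "0 < s" for \<epsilon> s :: real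
  proof -
    have e: "complex_of_real \<epsilon> * complex_of_real \<epsilon> = 1"
      using \<epsilon> by (simp add: power2_eq_square flip: of_real_mult)
    have "(P \<epsilon> has_vector_derivative
       exp (\<i> * of_real (- \<epsilon> * s)) * ((w1 s - \<i> * of_real \<epsilon> * (- (of_real (1 + 1 / (4 * s\<^sup>2)) * w s))) / 2)
       + exp (\<i> * of_real (- \<epsilon> * s)) * (\<i> * of_real (- \<epsilon>)) * ((w s - \<i> * of_real \<epsilon> * w1 s) / 2)) (at s)"
      unfolding P_def[abs_def] using s
      by (intro has_vector_derivative_mult has_vector_derivative_cis has_vector_derivative_divide
          has_vector_derivative_diff has_vector_derivative_mult_right dw dw1) (auto intro!: derivative_eq_intros)
    also have "exp (\<i> * of_real (- \<epsilon> * s)) * ((w1 s - \<i> * of_real \<epsilon> * (- (of_real (1 + 1 / (4 * s\<^sup>2)) * w s))) / 2)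
       + exp (\<i> * of_real (- \<epsilon> * s)) * (\<i> * of_real (- \<epsilon>)) * ((w s - \<i> * of_real \<epsilon> * w1 s) / 2)
       = exp (\<i> * of_real (- \<epsilon> * s)) * ((w1 s * (1 - of_real \<epsilon> * of_real \<epsilon>)) / 2 + \<i> * of_real \<epsilon> * w s * of_real (1 / (8 * s\<^sup>2)))"
      by (simp add: algebra_simps add_divide_distrib diff_divide_distrib)
    also have "\<dots> = P' \<epsilon> s" by (simp add: e P'_def)
    finally show ?thesis .
  qed
  \<comment> \<open>The summands serve, in order, the amplitudes, their derivatives, the range
    \<open>s < s1\<close> where the trivial bound 2 pi is used, and positivity.\<close>
  define M where "M = M0 + M0 / (8 * s1) + 2 * pi * sqrt s1 + 1"
  have M: "0 < M" "M0 \<le> M" "M0 / (8 * s1) \<le> M" "2 * pi * sqrt s1 \<le> M"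
    using M0 s1 by (auto simp: M_def add_nonneg_pos intro!: add_nonneg_nonneg)
  show ?thesis
  proof (rule that[OF M(1), of P P'])
    fix s :: real assume s: "0 < s"
    show "cmod (circle_wave s) \<le> M / sqrt s"
    proof (cases "s1 \<le> s")
      case True
      then have "sqrt s * cmod (circle_wave s) \<le> M"
        using w_le(1)[of s] M(2) s by (simp add: w_def norm_mult)
      then show ?thesis using s by (simp add: field_simps)
    next
      case False
      have "cmod (circle_wave s) * sqrt s \<le> 2 * pi * sqrt s1"
        using False by (intro mult_mono norm_circle_wave_le) (auto intro: order_trans[OF norm_ge_zero norm_circle_wave_le] simp: s less_imp_le)
      then show ?thesis using s M(4) by (simp add: field_simps)
    qed
    show "of_real (sqrt s) * circle_wave s = exp (\<i> * of_real s) * P 1 s + exp (- \<i> * of_real s) * P (-1) s"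
      unfolding w_def[symmetric]
      by (simp add: P_def add_divide_distrib diff_divide_distrib algebra_simps
           flip: exp_add mult.assoc)
  next
    fix \<epsilon> s :: real assume \<epsilon>: "\<epsilon>\<^sup>2 = 1" and s: "s1 \<le> s"
    have [simp]: "\<bar>\<epsilon>\<bar> = 1" using \<epsilon> by (simp add: abs_square_eq_1)
    have s0: "0 < s" using s s1 by simp
    have "cmod (P \<epsilon> s) = cmod (w s - \<i> * of_real \<epsilon> * w1 s) / 2"
      by (simp add: P_def norm_mult norm_divide del: of_real_mult of_real_minus)
    also have "\<dots> \<le> (cmod (w s) + cmod (w1 s)) / 2"
      using norm_triangle_ineq4[of "w s" "\<i> * of_real \<epsilon> * w1 s"] by (simp add: norm_mult)
    also have "\<dots> \<le> M" using w_le[OF s] M(2) by simp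
    finally show "cmod (P \<epsilon> s) \<le> M" .
    have "cmod (P' \<epsilon> s) = cmod (w s) / (8 * s\<^sup>2)"
      by (simp add: P'_def norm_mult norm_divide norm_power del: of_real_mult of_real_minus)
    \<comment> \<open>One of the two factors \<open>s\<close> is traded for \<open>s1\<close>. Decay
      like 1 / s is what the application needs: K times the derivative of
      \<open>P \<epsilon>\<close> at \<open>K * r\<close> is then of size 1 / r, uniformly in
      K.\<close>
    also have "\<dots> \<le> M0 / (8 * s1 * s)"
      using w_le(1)[OF s] s s1 M0 by (intro frac_le) (auto simp: power2_eq_square)
    also have "\<dots> \<le> M / s" using M(3) s0 by (simp add: divide_right_mono flip: divide_divide_eq_left)
    finally show "cmod (P' \<epsilon> s) \<le> M / s" .
  qed (use dP in auto)
qed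

subsection \<open>Plane waves against radial functions\<close>

text \<open>In polar coordinates for \<open>(a, b)\<close> the phase is
  \<open>\<rho> * cos (\<theta> - \<phi>)\<close>. The integral does not depend on the shift: its
  derivative in the shift is the integral over a full period of minus the derivative in
  \<open>\<theta>\<close>, which vanishes.\<close>

lemma circle_wave_shift:
  "integral {0..2 * pi} (\<lambda>\<theta>. exp (\<i> * of_real (a * cos \<theta> + b * sin \<theta>))) = circle_wave (sqrt (a\<^sup>2 + b\<^sup>2))"
proof -
  define \<rho> where "\<rho> = sqrt (a\<^sup>2 + b\<^sup>2)"
  obtain \<phi> where \<phi>: "a = \<rho> * cos \<phi>" "b = \<rho> * sin \<phi>"
  proof (cases "\<rho> = 0")
    case True
    then have "a = 0" "b = 0" by (simp_all add: \<rho>_def sum_power2_eq_zero_iff)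
    then show ?thesis using that True by simp
  next
    case False
    have \<rho>2: "\<rho>\<^sup>2 = a\<^sup>2 + b\<^sup>2" by (simp add: \<rho>_def)
    have "(a / \<rho>)\<^sup>2 + (b / \<rho>)\<^sup>2 = \<rho>\<^sup>2 / \<rho>\<^sup>2"
      unfolding \<rho>2 power_divide by (rule add_divide_distrib[symmetric])
    then have "(a / \<rho>)\<^sup>2 + (b / \<rho>)\<^sup>2 = 1" using False by simp
    then obtain t where "a / \<rho> = cos t" "b / \<rho> = sin t" by (rule sincos_total_2pi)
    then show ?thesis using that[of t] False by (simp add: field_simps)
  qed
  define h where "h t = integral {0..2 * pi} (\<lambda>\<theta>. exp (\<i> * of_real (\<rho> * cos (\<theta> - t))))" for t
  have "(h has_vector_derivative 0) (at t)" for t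
  proof -
    have "((\<lambda>t. integral (cbox 0 (2 * pi)) (\<lambda>\<theta>. exp (\<i> * of_real (\<rho> * cos (\<theta> - t))))) has_vector_derivative
        integral (cbox 0 (2 * pi)) (\<lambda>\<theta>. exp (\<i> * of_real (\<rho> * cos (\<theta> - t))) * (\<i> * of_real (\<rho> * sin (\<theta> - t))))) (at t)"
      by (rule leibniz_rule_vector_derivative)
         (auto simp: split_beta intro!: continuous_intros integrable_continuous_real has_vector_derivative_cis
           derivative_eq_intros simp del: of_real_mult)
    moreover have "((\<lambda>\<theta>. exp (\<i> * of_real (\<rho> * cos (\<theta> - t))) * (\<i> * of_real (\<rho> * sin (\<theta> - t)))) has_integral
        - exp (\<i> * of_real (\<rho> * cos (2 * pi - t))) - - exp (\<i> * of_real (\<rho> * cos (0 - t)))) {0..2 * pi}"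
    proof (rule fundamental_theorem_of_calculus)
      fix \<theta>
      have "((\<lambda>\<theta>. - exp (\<i> * of_real (\<rho> * cos (\<theta> - t)))) has_vector_derivative
         - (exp (\<i> * of_real (\<rho> * cos (\<theta> - t))) * (\<i> * of_real (\<rho> * - sin (\<theta> - t))))) (at \<theta> within {0..2 * pi})"
        by (intro has_vector_derivative_minus has_vector_derivative_cis) (auto intro!: derivative_eq_intros)
      then show "((\<lambda>\<theta>. - exp (\<i> * of_real (\<rho> * cos (\<theta> - t)))) has_vector_derivative
         exp (\<i> * of_real (\<rho> * cos (\<theta> - t))) * (\<i> * of_real (\<rho> * sin (\<theta> - t)))) (at \<theta> within {0..2 * pi})" by simp
    qed simp
    ultimately show ?thesis by (simp add: h_def[abs_def] integral_unique cos_diff)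
  qed
  then have "(h has_derivative (\<lambda>_. 0)) (at t within UNIV)" for t
    by (simp add: has_vector_derivative_def)
  then obtain c where "\<And>t. t \<in> UNIV \<Longrightarrow> h t = c"
    using has_derivative_zero_constant[OF convex_UNIV] by metis
  then have "h \<phi> = h 0" by simp
  then show ?thesis
    unfolding \<rho>_def[symmetric] by (simp add: h_def circle_wave_def \<phi> cos_diff algebra_simps)
qed

section \<open>Rotation invariance of Lebesgue measure and polar coordinates in the plane\<close>

definition quarter_turn :: "real ^ 2 \<Rightarrow> real ^ 2" where
  "quarter_turn \<xi> = vector [- \<xi> $ 2, \<xi> $ 1]"

text \<open>Rotation by \<open>\<theta>\<close>, written so that
  \<open>x \<bullet> turn \<theta> \<xi>\<close> takes the form
  \<open>a * cos \<theta> + b * sin \<theta>\<close> of \<open>circle_wave_shift\<close>.\<close>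

definition turn :: "real \<Rightarrow> real ^ 2 \<Rightarrow> real ^ 2" where
  "turn \<theta> \<xi> = cos \<theta> *\<^sub>R \<xi> + sin \<theta> *\<^sub>R quarter_turn \<xi>"

lemma turn_components:
  "turn \<theta> \<xi> $ 1 = cos \<theta> * \<xi> $ 1 - sin \<theta> * \<xi> $ 2" "turn \<theta> \<xi> $ 2 = cos \<theta> * \<xi> $ 2 + sin \<theta> * \<xi> $ 1"
  by (simp_all add: turn_def quarter_turn_def)

text \<open>Pythagoras, since \<open>\<xi>\<close> and \<open>quarter_turn \<xi>\<close> are
  orthogonal and of equal length. It makes the argument of the circle integral depend on
  \<open>x\<close> and \<open>\<xi>\<close> through their norms only.\<close>

lemma inner_quarter_turn: "(x \<bullet> \<xi>)\<^sup>2 + (x \<bullet> quarter_turn \<xi>)\<^sup>2 = (norm x * norm \<xi>)\<^sup>2"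
  by (simp add: power_mult_distrib power2_norm_eq_inner inner_vec_def sum_2 quarter_turn_def)
     (simp add: power2_eq_square algebra_simps)

lemma turn_turn: "turn (- \<theta>) (turn \<theta> \<xi>) = \<xi>"
proof -
  have "cos \<theta> * (cos \<theta> * a) + sin \<theta> * (sin \<theta> * a) = a" for a
    using sin_cos_squared_add[of \<theta>] by algebra
  from this[of "\<xi> $ 1"] this[of "\<xi> $ 2"] show ?thesis by (simp add: vec_eq_iff forall_2 turn_components algebra_simps)
qed

lemma orthogonal_transformation_turn: "orthogonal_transformation (turn \<theta>)"
proof -
  have "linear (turn \<theta>)"
    by (rule linearI) (simp_all add: vec_eq_iff forall_2 turn_components algebra_simps)
  moreover have "norm (turn \<theta> \<xi>) = norm \<xi>" for \<xi>
  proof -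
    have "(turn \<theta> \<xi> $ 1)\<^sup>2 + (turn \<theta> \<xi> $ 2)\<^sup>2 = ((sin \<theta>)\<^sup>2 + (cos \<theta>)\<^sup>2) * ((\<xi> $ 1)\<^sup>2 + (\<xi> $ 2)\<^sup>2)"
      unfolding turn_components by algebra
    then show ?thesis by (simp add: norm_vec_def L2_set_def sum_2)
  qed
  ultimately show ?thesis by (simp add: orthogonal_transformation)
qed

lemma turn_measurable [measurable]: "turn \<theta> \<in> borel_measurable borel"
  using orthogonal_transformation_turn[of \<theta>]
  by (intro borel_measurable_continuous_onI linear_continuous_on linear_conv_bounded_linear[THEN iffD1])
     (rule orthogonal_transformation_linear)

text \<open>It suffices to test boxes. The preimage of a box is its image under the inverse
  rotation, and orthogonal maps preserve Lebesgue measure.\<close>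

lemma lborel_distr_turn: "distr lborel borel (turn \<theta>) = lborel"
proof (rule lborel_eqI[symmetric])
  fix l u :: "real ^ 2" assume lu: "\<And>b. b \<in> Basis \<Longrightarrow> l \<bullet> b \<le> u \<bullet> b"
  have eq: "turn \<theta> -` box l u = turn (- \<theta>) ` box l u"
  proof (intro set_eqI iffI)
    fix \<xi> assume "\<xi> \<in> turn \<theta> -` box l u"
    then show "\<xi> \<in> turn (- \<theta>) ` box l u" by (metis imageI turn_turn vimageD)
  next
    fix \<xi> assume "\<xi> \<in> turn (- \<theta>) ` box l u"
    then show "\<xi> \<in> turn \<theta> -` box l u" using turn_turn[of "- \<theta>"] by auto
  qed
  have B: "turn (- \<theta>) ` box l u \<in> sets borel"
    unfolding eq[symmetric] using measurable_sets_borel[OF turn_measurable, of "box l u" \<theta>] by simp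
  have lm: "turn (- \<theta>) ` box l u \<in> lmeasurable"
    by (rule measurable_orthogonal_image[OF orthogonal_transformation_turn]) simp
  have "emeasure (distr lborel borel (turn \<theta>)) (box l u) = emeasure lborel (turn (- \<theta>) ` box l u)"
    by (simp add: emeasure_distr eq)
  also have "\<dots> = emeasure lebesgue (turn (- \<theta>) ` box l u)"
    using B by simp
  also have "\<dots> = ennreal (measure lebesgue (turn (- \<theta>) ` box l u))"
    using lm by (simp add: emeasure_eq_measure2)
  also have "\<dots> = ennreal (measure lebesgue (box l u))"
    by (subst measure_orthogonal_image[OF orthogonal_transformation_turn]) simp_all
  also have "\<dots> = (\<Prod>b\<in>Basis. (u - l) \<bullet> b)"
    using lu by (simp add: measure_lborel_box_eq)
  finally show "emeasure (distr lborel borel (turn \<theta>)) (box l u) = (\<Prod>b\<in>Basis. (u - l) \<bullet> b)" .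
qed simp

text \<open>Polar coordinates for radial functions. On a half-line \<open>{..a}\<close> the
  pushed-forward measure is the area of a disk, the density integrates to the same value, and these
  half-lines generate the Borel sets.\<close>

lemma lborel_distr_norm:
  "distr (lborel :: (real ^ 2) measure) borel norm = density lborel (\<lambda>r. ennreal (2 * pi * r * indicator {0..} r))"
proof (rule measure_eqI_generator_eq[where E = "range (\<lambda>a::real. {..a})" and \<Omega> = UNIV and A = "\<lambda>n. {..real n}"])
  show "Int_stable (range (\<lambda>a::real. {..a}))"
    by (auto simp: Int_stable_def)
  fix X :: "real set" assume "X \<in> range (\<lambda>a. {..a})"
  then obtain a where X: "X = {..a}" by auto
  have "emeasure (distr (lborel :: (real ^ 2) measure) borel norm) {..a} = emeasure lborel (cball (0 :: real ^ 2) a)"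
    by (simp add: emeasure_distr vimage_def cball_def)
  \<comment> \<open>The maximum accounts for negative \<open>a\<close>, where the disk is
    empty.\<close>
  also have "\<dots> = ennreal (pi * (max 0 a)\<^sup>2)"
    by (cases "0 \<le> a") (auto simp: emeasure_cball unit_ball_vol_2)
  also have "\<dots> = (\<integral>\<^sup>+ r. ennreal (2 * pi * r) * indicator {0..max 0 a} r \<partial>lborel)"
  proof -
    have "(\<integral>\<^sup>+ r. ennreal (2 * pi * r) * indicator {0..max 0 a} r \<partial>lborel) = pi * (max 0 a)\<^sup>2 - pi * 0\<^sup>2"
      by (rule nn_integral_FTC_Icc) (auto intro!: derivative_eq_intros)
    then show ?thesis by simp
  qed
  also have "\<dots> = (\<integral>\<^sup>+ r. ennreal (2 * pi * r * indicator {0..} r) * indicator {..a} r \<partial>lborel)"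
  proof (rule nn_integral_cong_AE)
    have "AE r in lborel. r \<noteq> (0::real)" by (rule AE_lborel_singleton)
    then show "AE r in lborel. ennreal (2 * pi * r) * indicator {0..max 0 a} r
        = ennreal (2 * pi * r * indicator {0..} r) * indicator {..a} r"
      by eventually_elim (auto simp: indicator_def max_def)
  qed
  also have "\<dots> = emeasure (density lborel (\<lambda>r. ennreal (2 * pi * r * indicator {0..} r))) {..a}"
    by (simp add: emeasure_density)
  finally show "emeasure (distr (lborel :: (real ^ 2) measure) borel norm) X
      = emeasure (density lborel (\<lambda>r. ennreal (2 * pi * r * indicator {0..} r))) X" using X by simp
next
  fix n :: nat
  have "emeasure (distr (lborel :: (real ^ 2) measure) borel norm) {..real n} = emeasure lborel (cball (0 :: real ^ 2) (real n))"
    by (simp add: emeasure_distr vimage_def cball_def)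
  then show "emeasure (distr (lborel :: (real ^ 2) measure) borel norm) {..real n} \<noteq> \<infinity>"
    by (simp add: emeasure_cball)
next
  show "(\<Union>n. {..real n}) = UNIV" by (auto simp: real_arch_simple)
qed (auto simp: borel_eq_atMost sets_measure_of_conv)

lemma integral_radial:
  fixes H :: "real \<Rightarrow> complex"
  assumes [measurable]: "H \<in> borel_measurable borel"
  shows "(LINT \<xi>|(lborel :: (real ^ 2) measure). H (norm \<xi>)) = (LINT r|lborel. (2 * pi * r * indicator {0..} r) *\<^sub>R H r)"
proof -
  have "(LINT \<xi>|(lborel :: (real ^ 2) measure). H (norm \<xi>)) = (LINT r|distr (lborel :: (real ^ 2) measure) borel norm. H r)"
    by (rule integral_distr[symmetric]) auto
  also have "\<dots> = (LINT r|lborel. (2 * pi * r * indicator {0..} r) *\<^sub>R H r)"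
    unfolding lborel_distr_norm
    by (rule integral_density) (auto simp: indicator_def)
  finally show ?thesis .
qed

lemma circle_wave_continuous: "continuous_on UNIV circle_wave"
  by (meson continuous_at_imp_continuous_on has_vector_derivative_circle_wave has_vector_derivative_continuous)

text \<open>Rotating the variable changes neither the measure nor the radial factor, so the integral
  equals its average over all angles. Fubini then turns the plane wave into the circle integral, and
  the 2 pi of the averaging cancels against the one in the polar density.\<close>

theorem integral_plane_wave_radial:
  fixes F :: "real \<Rightarrow> complex" and x :: "real ^ 2"
  assumes F: "continuous_on {0..} F" and R: "0 < R" "\<And>r. R \<le> r \<Longrightarrow> F r = 0"
  shows "(LINT \<xi>|lborel. exp (\<i> * of_real (x \<bullet> \<xi>)) * F (norm \<xi>))
       = integral {0..R} (\<lambda>r. of_real r * F r * circle_wave (norm x * r))"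
proof -
  define H where "H \<xi> = F (norm \<xi>)" for \<xi> :: "real ^ 2"
  have cH: "continuous_on UNIV H"
    unfolding H_def by (rule continuous_on_compose2[OF F]) (auto intro: continuous_intros)
  then have [measurable]: "H \<in> borel_measurable borel" by (rule borel_measurable_continuous_onI)
  have iH: "integrable lborel H"
  proof -
    have "integrable lborel (\<lambda>\<xi>. indicator (cball 0 R) \<xi> *\<^sub>R H \<xi>)"
      by (rule borel_integrable_compact) (auto intro: continuous_on_subset[OF cH])
    moreover have "(\<lambda>\<xi>. indicator (cball 0 R) \<xi> *\<^sub>R H \<xi>) = H"
      using R(2) by (auto simp: fun_eq_iff H_def indicator_def)
    ultimately show ?thesis by simp
  qed
  have [measurable]: "circle_wave \<in> borel_measurable borel"
    by (rule borel_measurable_continuous_onI[OF circle_wave_continuous])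
  have [measurable]: "quarter_turn \<in> borel_measurable borel"
    using turn_measurable[of "pi / 2"] by (simp add: turn_def[abs_def])
  define I where "I = (LINT \<xi>|lborel. exp (\<i> * of_real (x \<bullet> \<xi>)) * H \<xi>)"
  have I_turn: "I = (LINT \<xi>|lborel. exp (\<i> * of_real (x \<bullet> turn \<theta> \<xi>)) * H \<xi>)" for \<theta>
  proof -
    have "I = (LINT \<xi>|distr lborel borel (turn \<theta>). exp (\<i> * of_real (x \<bullet> \<xi>)) * H \<xi>)"
      by (simp add: I_def lborel_distr_turn)
    also have "\<dots> = (LINT \<xi>|lborel. exp (\<i> * of_real (x \<bullet> turn \<theta> \<xi>)) * H (turn \<theta> \<xi>))"
      by (rule integral_distr) auto
    finally show ?thesis
      using orthogonal_transformation_turn[of \<theta>] by (simp add: H_def orthogonal_transformation)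
  qed
  \<comment> \<open>The indicator moves the angular interval into the integrand, so that Fubini
    applies to a product of two full Lebesgue measures.\<close>
  define G where "G = (\<lambda>\<theta> \<xi>. indicator {0..2 * pi} \<theta> *\<^sub>R (exp (\<i> * of_real (x \<bullet> turn \<theta> \<xi>)) * H \<xi>))"
  have G_meas: "case_prod G \<in> borel_measurable (lborel \<Otimes>\<^sub>M lborel)"
    unfolding G_def turn_def split_beta inner_add_right inner_scaleR_right by measurable
  have nG: "norm (G \<theta> \<xi>) = indicator {0..2 * pi} \<theta> * cmod (H \<xi>)" for \<theta> \<xi>
    by (simp add: G_def norm_mult)
  have G_int: "integrable (lborel \<Otimes>\<^sub>M lborel) (case_prod G)"
  proof (rule lborel_pair.Fubini_integrable[OF G_meas])
    have "integrable lborel (\<lambda>\<theta>. indicator {0..2 * pi} \<theta> * (LINT \<xi>|lborel. cmod (H \<xi>)))"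
      by (intro integrable_mult_left) simp
    then show "integrable lborel (\<lambda>\<theta>. LINT \<xi>|lborel. norm (case_prod G (\<theta>, \<xi>)))"
      by (simp add: nG)
    have "integrable lborel (G \<theta>)" for \<theta>
    proof (rule Bochner_Integration.integrable_bound[OF iH])
      show "G \<theta> \<in> borel_measurable lborel" unfolding G_def by measurable
    qed (auto simp: nG indicator_def)
    then show "AE \<theta> in lborel. integrable lborel (\<lambda>\<xi>. case_prod G (\<theta>, \<xi>))" by simp
  qed
  have "2 * pi * I = (LINT \<theta>|lborel. indicator {0..2 * pi} \<theta> *\<^sub>R I)"
    by (simp add: scaleR_conv_of_real)
  also have "\<dots> = (LINT \<theta>|lborel. LINT \<xi>|lborel. G \<theta> \<xi>)"
    by (simp add: G_def flip: I_turn)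
  also have "\<dots> = (LINT \<xi>|lborel. LINT \<theta>|lborel. G \<theta> \<xi>)"
    by (rule lborel_pair.Fubini_integral[symmetric]) (use G_int in \<open>simp add: lborel_pair.integrable_product_swap_iff\<close>)
  also have "\<dots> = (LINT \<xi>|lborel. circle_wave (norm x * norm \<xi>) * H \<xi>)"
  proof (rule Bochner_Integration.integral_cong[OF refl])
    fix \<xi> :: "real ^ 2"
    have "(LINT \<theta>|lborel. G \<theta> \<xi>) = (LINT \<theta>:{0..2 * pi}|lborel. exp (\<i> * of_real (x \<bullet> turn \<theta> \<xi>))) * H \<xi>"
      by (simp add: G_def set_lebesgue_integral_def flip: integral_mult_left_zero mult_scaleR_left)
    also have "(LINT \<theta>:{0..2 * pi}|lborel. exp (\<i> * of_real (x \<bullet> turn \<theta> \<xi>)))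
        = integral {0..2 * pi} (\<lambda>\<theta>. exp (\<i> * of_real (x \<bullet> turn \<theta> \<xi>)))"
      by (rule set_borel_integral_eq_integral, rule borel_integrable_atLeastAtMost')
         (auto simp: turn_def intro!: continuous_intros)
    also have "\<dots> = circle_wave (sqrt ((x \<bullet> \<xi>)\<^sup>2 + (x \<bullet> quarter_turn \<xi>)\<^sup>2))"
      unfolding circle_wave_shift[symmetric] by (simp add: turn_def inner_add_right mult.commute)
    also have "\<dots> = circle_wave (norm x * norm \<xi>)"
      by (simp add: inner_quarter_turn)
    finally show "(LINT \<theta>|lborel. G \<theta> \<xi>) = circle_wave (norm x * norm \<xi>) * H \<xi>" .
  qed
  \<comment> \<open>Continuity of \<open>F\<close> is known on the nonnegative half-line only.
    Cutting it off there gives a Borel function on the whole line with the same values at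
    norms.\<close>
  also have "\<dots> = (LINT \<xi>|(lborel :: (real ^ 2) measure). (\<lambda>r. circle_wave (norm x * r) * (indicator {0..} r *\<^sub>R F r)) (norm \<xi>))"
    by (simp add: H_def)
  also have "\<dots> = (LINT r|lborel. (2 * pi * r * indicator {0..} r) *\<^sub>R (circle_wave (norm x * r) * (indicator {0..} r *\<^sub>R F r)))"
  proof (rule integral_radial)
    have [measurable]: "(\<lambda>r. indicator {0..} r *\<^sub>R F r) \<in> borel_measurable borel"
      by (rule borel_measurable_continuous_on_indicator[OF _ F]) simp
    show "(\<lambda>r. circle_wave (norm x * r) * (indicator {0..} r *\<^sub>R F r)) \<in> borel_measurable borel"
      by measurable
  qed
  also have "\<dots> = (LINT r|lborel. (2 * pi) * (indicator {0..R} r *\<^sub>R (of_real r * F r * circle_wave (norm x * r))))"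
    by (rule Bochner_Integration.integral_cong[OF refl]) (use R in \<open>auto simp: indicator_def scaleR_conv_of_real\<close>)
  also have "\<dots> = 2 * pi * (LINT r:{0..R}|lborel. of_real r * F r * circle_wave (norm x * r))"
    by (simp only: set_lebesgue_integral_def integral_mult_right_zero)
  also have "(LINT r:{0..R}|lborel. of_real r * F r * circle_wave (norm x * r))
      = integral {0..R} (\<lambda>r. of_real r * F r * circle_wave (norm x * r))"
    by (rule set_borel_integral_eq_integral, rule borel_integrable_atLeastAtMost')
       (auto intro!: continuous_intros continuous_on_subset[OF F] continuous_on_compose2[OF circle_wave_continuous])
  finally show ?thesis by (simp add: I_def H_def)
qed

subsection \<open>The radial integral\<close>

text \<open>The hypotheses in the form the estimates consume: \<open>\<sigma>\<close> records the
  sign of \<open>g''\<close>, so that the curvature bound is free of absolute values, and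
  \<open>M0\<close> bounds the cutoff together with its derivative.\<close>

locale radial_phase =
  fixes \<alpha> lam y0 M0 \<sigma> :: real and g g' g'' :: "real \<Rightarrow> real" and chi chi' :: "real \<Rightarrow> complex"
  assumes alpha: "1 \<le> \<alpha>" and lam: "0 < lam" and y0: "0 < y0"
    and deriv_g: "\<And>y. 0 < y \<Longrightarrow> (g has_real_derivative g' y) (at y)"
    and deriv_g': "\<And>y. 0 < y \<Longrightarrow> (g' has_real_derivative g'' y) (at y)"
    and cont_g: "continuous_on {0..} g" and cont_g': "continuous_on {0..} g'"
    and g'_lower: "\<And>y. 0 \<le> y \<Longrightarrow> y \<le> y0 \<Longrightarrow> lam \<le> \<bar>g' y\<bar>"
    and sigma: "\<sigma> = 1 \<or> \<sigma> = -1"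
    and g''_lower: "\<And>y. 0 < y \<Longrightarrow> y \<le> y0 \<Longrightarrow> lam * y powr \<alpha> \<le> \<sigma> * g'' y"
    and deriv_chi: "\<And>y. 0 < y \<Longrightarrow> (chi has_vector_derivative chi' y) (at y)"
    and cont_chi: "continuous_on {0..} chi"
    and chi_le: "\<And>y. 0 \<le> y \<Longrightarrow> y \<le> y0 \<Longrightarrow> cmod (chi y) \<le> M0"
    and chi'_le: "\<And>y. 0 \<le> y \<Longrightarrow> y \<le> y0 \<Longrightarrow> cmod (chi' y) \<le> M0"
begin

definition J :: "real \<Rightarrow> real \<Rightarrow> complex" where
  "J \<tau> K = integral {0..y0}
     (\<lambda>r. of_real r * (exp (\<i> * of_real (\<tau> * g r)) * chi r) * circle_wave (K * r))"

text \<open>Equal to 1/2 + (3/2) / (2 + \<alpha>): the decay rate of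
  \<open>\<rho> powr (3 / 2) * T powr (- 1 / 2)\<close> for
  \<open>\<rho> = T powr (- 1 / (2 + \<alpha>))\<close>.\<close>

definition exponent :: real where "exponent = (5 + \<alpha>) / (2 * (2 + \<alpha>))"

text \<open>The upper bound amounts to \<open>1 \<le> \<alpha>\<close> and lets a bound of order 1 /
  |\<tau>| be absorbed for |\<tau>| \<ge> 1; positivity lets a constant bound be absorbed for
  smaller |\<tau>|.\<close>

lemma exponent_bounds: "0 < exponent" "exponent \<le> 1"
  using alpha by (simp_all add: exponent_def field_simps)

lemma M0_nonneg: "0 \<le> M0"
  using order_trans[OF norm_ge_zero chi_le[of y0]] y0 by simp

lemma cont_J: "continuous_on {0..y0} (\<lambda>r. of_real r * (exp (\<i> * of_real (\<tau> * g r)) * chi r) * circle_wave (K * r))"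
  by (intro continuous_intros continuous_on_subset[OF cont_g] continuous_on_subset[OF cont_chi]
      continuous_on_compose2[OF circle_wave_continuous]) auto

lemma phase_derivs:
  assumes "0 < r"
  shows "((\<lambda>r. \<tau> * g r + k * r) has_real_derivative \<tau> * g' r + k) (at r)"
    "((\<lambda>r. \<tau> * g' r + k) has_real_derivative \<tau> * g'' r) (at r)"
  by (auto intro!: derivative_eq_intros deriv_g deriv_g' assms)

text \<open>A linear term does not affect the second derivative, so a single sign serves all the
  phases \<open>\<tau> * g r + k * r\<close>.\<close>

lemma phase_sign:
  assumes "\<tau> \<noteq> 0"
  shows "\<sigma> * sgn \<tau> = 1 \<or> \<sigma> * sgn \<tau> = -1"
    "0 < r \<Longrightarrow> r \<le> y0 \<Longrightarrow> lam * \<bar>\<tau>\<bar> * r powr \<alpha> \<le> \<sigma> * sgn \<tau> * (\<tau> * g'' r)"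
proof -
  show "\<sigma> * sgn \<tau> = 1 \<or> \<sigma> * sgn \<tau> = -1" using sigma assms by (auto simp: sgn_if)
  assume r: "0 < r" "r \<le> y0"
  have "\<bar>\<tau>\<bar> * (lam * r powr \<alpha>) \<le> \<bar>\<tau>\<bar> * (\<sigma> * g'' r)"
    by (rule mult_left_mono[OF g''_lower[OF r]]) simp
  also have "\<dots> = \<sigma> * sgn \<tau> * (\<tau> * g'' r)" by (simp add: abs_sgn mult_ac)
  finally show "lam * \<bar>\<tau>\<bar> * r powr \<alpha> \<le> \<sigma> * sgn \<tau> * (\<tau> * g'' r)" by (simp add: mult_ac)
qed

lemma J_trivial: "cmod (J \<tau> K) \<le> 2 * pi * M0 * y0\<^sup>2"
proof -
  have "cmod (J \<tau> K) \<le> y0 * (M0 * (2 * pi)) * (y0 - 0)"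
    unfolding J_def
  proof (rule integral_bound[OF _ cont_J])
    fix r assume r: "r \<in> {0..y0}"
    then have "r * (cmod (chi r) * cmod (circle_wave (K * r))) \<le> y0 * (M0 * (2 * pi))"
      using M0_nonneg by (intro mult_mono norm_circle_wave_le chi_le) auto
    then show "cmod (of_real r * (exp (\<i> * of_real (\<tau> * g r)) * chi r) * circle_wave (K * r)) \<le> y0 * (M0 * (2 * pi))"
      using r by (simp add: norm_mult mult.assoc del: of_real_mult)
  qed (use y0 in auto)
  then show ?thesis by (simp add: power2_eq_square mult_ac)
qed

text \<open>After exchanging the order of integration, the radial phase for fixed
  \<open>\<theta>\<close> has derivative \<open>\<tau> * g' r + K * cos \<theta>\<close>. Its
  modulus is at least \<open>lam * \<bar>\<tau>\<bar> - K\<close>, hence at least half of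
  \<open>lam * \<bar>\<tau>\<bar>\<close>, and one integration by parts suffices for each
  angle.\<close>

lemma J_low_frequency:
  assumes \<tau>: "\<tau> \<noteq> 0" and K: "0 \<le> K" "K \<le> lam * \<bar>\<tau>\<bar> / 2"
  shows "cmod (J \<tau> K) \<le> 16 * pi * M0 * (1 + y0) * y0 / lam / \<bar>\<tau>\<bar>"
proof -
  define f where "f \<theta> r = \<tau> * g r + K * cos \<theta> * r" for \<theta> r
  define A where "A r = of_real r * chi r" for r
  \<comment> \<open>\<open>N\<close> bounds both \<open>chi\<close> and the derivative of
    \<open>r * chi r\<close>, so the linear function \<open>N * r\<close> majorizes the amplitude
    and its slope majorizes the derivative.\<close>
  define N where "N = M0 * (1 + y0)"
  have cA: "continuous_on {0..y0} A" unfolding A_def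
    by (intro continuous_intros continuous_on_subset[OF cont_chi]) auto
  have cf: "continuous_on ({0..2 * pi} \<times> {0..y0}) (\<lambda>(\<theta>, r). exp (\<i> * of_real (f \<theta> r)) * A r)"
    unfolding f_def split_beta
    by (intro continuous_intros continuous_on_compose2[OF cont_g] continuous_on_compose2[OF cA]) auto
  have inner: "cmod (integral {0..y0} (\<lambda>r. exp (\<i> * of_real (f \<theta> r)) * A r)) \<le> 4 * (N * y0) / (lam * \<bar>\<tau>\<bar> / 2)" for \<theta>
  proof (rule nonstationary_phase[where s = "\<sigma> * sgn \<tau>" and f' = "\<lambda>r. \<tau> * g' r + K * cos \<theta>" and f'' = "\<lambda>r. \<tau> * g'' r"
        and A' = "\<lambda>r. of_real r * chi' r + chi r" and w = "\<lambda>r. N * r" and w' = "\<lambda>_. N"])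
    show "continuous_on {0..y0} (f \<theta>)" unfolding f_def
      by (intro continuous_intros continuous_on_subset[OF cont_g]) auto
    show "continuous_on {0..y0} (\<lambda>r. \<tau> * g' r + K * cos \<theta>)"
      by (intro continuous_intros continuous_on_subset[OF cont_g']) auto
    show "(f \<theta> has_real_derivative \<tau> * g' r + K * cos \<theta>) (at r)" if "0 < r" for r
      unfolding f_def by (rule phase_derivs[OF that])
    show "((\<lambda>r. \<tau> * g' r + K * cos \<theta>) has_real_derivative \<tau> * g'' r) (at r)" if "0 < r" for r
      by (rule phase_derivs[OF that])
    show "0 < lam * \<bar>\<tau>\<bar> / 2" using lam \<tau> by simp
    show "\<sigma> * sgn \<tau> = 1 \<or> \<sigma> * sgn \<tau> = -1" by (rule phase_sign[OF \<tau>])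
    show "0 \<le> \<sigma> * sgn \<tau> * (\<tau> * g'' r)" if "0 < r" "r < y0" for r
      using phase_sign(2)[OF \<tau>, of r] that lam by (intro order_trans[OF _ phase_sign(2)[OF \<tau>]]) auto
    show "(A has_vector_derivative of_real r * chi' r + chi r) (at r)" if "0 < r" for r
    proof -
      have "(A has_vector_derivative of_real r * chi' r + of_real 1 * chi r) (at r)"
        unfolding A_def
        by (intro has_vector_derivative_mult deriv_chi that has_vector_derivative_of_real) simp
      then show ?thesis by simp
    qed
    show "((\<lambda>r. N * r) has_real_derivative N) (at r)" for r
      by (auto intro!: derivative_eq_intros)
    fix r
    show "cmod (of_real r * chi' r + chi r) \<le> N" if r: "0 < r" "r < y0"
    proof -
      have "cmod (of_real r * chi' r + chi r) \<le> cmod (of_real r * chi' r) + cmod (chi r)" by (rule norm_triangle_ineq)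
      also have "\<dots> \<le> y0 * M0 + M0" unfolding norm_mult
        using r M0_nonneg by (intro add_mono mult_mono chi_le chi'_le) auto
      finally show ?thesis by (simp add: N_def algebra_simps)
    qed
    assume r: "0 \<le> r" "r \<le> y0"
    have "M0 * 1 \<le> N" unfolding N_def using M0_nonneg y0 by (intro mult_left_mono) auto
    then have "cmod (chi r) \<le> N" using chi_le[OF r] by simp
    then show "cmod (A r) \<le> N * r" using r by (simp add: A_def norm_mult mult.commute[of N] mult_left_mono)
    have "lam * \<bar>\<tau>\<bar> \<le> \<bar>g' r\<bar> * \<bar>\<tau>\<bar>" by (intro mult_right_mono g'_lower r) simp
    also have "\<dots> = \<bar>\<tau> * g' r\<bar>" by (simp add: abs_mult)
    finally have "lam * \<bar>\<tau>\<bar> \<le> \<bar>\<tau> * g' r\<bar>" .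
    moreover have "\<bar>K * cos \<theta>\<bar> \<le> K"
      using K mult_left_mono[OF abs_cos_le_one[of \<theta>], of K] by (simp add: abs_mult)
    ultimately show "lam * \<bar>\<tau>\<bar> / 2 \<le> \<bar>\<tau> * g' r + K * cos \<theta>\<bar>"
      using K by linarith
  qed (use y0 cA in \<open>auto intro!: continuous_intros\<close>)
  have "J \<tau> K = integral (cbox 0 y0) (\<lambda>r. integral (cbox 0 (2 * pi)) (\<lambda>\<theta>. exp (\<i> * of_real (f \<theta> r)) * A r))"
    unfolding J_def circle_wave_def cbox_interval
  proof (rule integral_cong)
    fix r
    have "of_real r * (exp (\<i> * of_real (\<tau> * g r)) * chi r) * integral {0..2 * pi} (\<lambda>\<theta>. exp (\<i> * of_real (K * r * cos \<theta>)))
       = integral {0..2 * pi} (\<lambda>\<theta>. of_real r * (exp (\<i> * of_real (\<tau> * g r)) * chi r) * exp (\<i> * of_real (K * r * cos \<theta>)))"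
      by simp
    also have "(\<lambda>\<theta>. of_real r * (exp (\<i> * of_real (\<tau> * g r)) * chi r) * exp (\<i> * of_real (K * r * cos \<theta>)))
       = (\<lambda>\<theta>. exp (\<i> * of_real (f \<theta> r)) * A r)"
      by (simp add: fun_eq_iff f_def A_def distrib_left exp_add mult_ac)
    finally show "of_real r * (exp (\<i> * of_real (\<tau> * g r)) * chi r) * integral {0..2 * pi} (\<lambda>\<theta>. exp (\<i> * of_real (K * r * cos \<theta>)))
       = integral {0..2 * pi} (\<lambda>\<theta>. exp (\<i> * of_real (f \<theta> r)) * A r)" .
  qed
  also have "\<dots> = integral (cbox 0 (2 * pi)) (\<lambda>\<theta>. integral (cbox 0 y0) (\<lambda>r. exp (\<i> * of_real (f \<theta> r)) * A r))"
    by (rule integral_swap_continuous[symmetric]) (use cf in \<open>simp add: cbox_Pair_eq\<close>)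
  finally have J: "J \<tau> K = integral {0..2 * pi} (\<lambda>\<theta>. integral {0..y0} (\<lambda>r. exp (\<i> * of_real (f \<theta> r)) * A r))"
    by simp
  have "cmod (J \<tau> K) \<le> 4 * (N * y0) / (lam * \<bar>\<tau>\<bar> / 2) * (2 * pi - 0)"
    unfolding J
  proof (rule integral_bound[OF _ _ inner])
    show "continuous_on {0..2 * pi} (\<lambda>\<theta>. integral {0..y0} (\<lambda>r. exp (\<i> * of_real (f \<theta> r)) * A r))"
      using integral_continuous_on_param[of "{0..2 * pi}" 0 y0 "\<lambda>\<theta> r. exp (\<i> * of_real (f \<theta> r)) * A r"] cf by simp
  qed simp
  then show ?thesis by (simp add: N_def mult_ac)
qed

text \<open>Up to the scale \<open>\<rho>\<close> the decay of the circle integral is used directly;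
  beyond it, its two exponential components are absorbed into the phase and
  \<open>degenerate_phase_estimate\<close> applies. Both parts carry \<open>1 / sqrt K\<close>, and
  the lower bound on \<open>K\<close> turns this into
  \<open>\<bar>\<tau>\<bar> powr (- 1 / 2)\<close>.\<close>

lemma J_high_frequency:
  obtains C where "0 < C"
    "\<And>\<tau> K. 1 \<le> \<bar>\<tau>\<bar> \<Longrightarrow> lam * \<bar>\<tau>\<bar> / 2 \<le> K \<Longrightarrow> cmod (J \<tau> K) \<le> C * \<bar>\<tau>\<bar> powr (- exponent)"
proof -
  obtain M P P' where M: "0 < M"
    and cw: "\<And>s. 0 < s \<Longrightarrow> cmod (circle_wave s) \<le> M / sqrt s"
      "\<And>s. 0 < s \<Longrightarrow> of_real (sqrt s) * circle_wave s
        = exp (\<i> * of_real s) * P (1::real) s + exp (- \<i> * of_real s) * P (-1) s"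
    and dP: "\<And>\<epsilon> s. \<epsilon>\<^sup>2 = 1 \<Longrightarrow> 0 < s \<Longrightarrow> (P \<epsilon> has_vector_derivative P' \<epsilon> s) (at s)"
    and P_le: "\<And>\<epsilon> s. \<epsilon>\<^sup>2 = 1 \<Longrightarrow> lam / 2 \<le> s \<Longrightarrow> cmod (P \<epsilon> s) \<le> M"
      "\<And>\<epsilon> s. \<epsilon>\<^sup>2 = 1 \<Longrightarrow> lam / 2 \<le> s \<Longrightarrow> cmod (P' \<epsilon> s) \<le> M / s"
    using half_gt_zero[OF lam] by (rule circle_wave_amplitudes) (rule that)
  \<comment> \<open>Differentiating the product of \<open>sqrt r\<close>, \<open>chi r\<close> and
    \<open>P \<epsilon> (K * r)\<close> gives three terms, bounded together by
    \<open>M0 * M * (3 + 2 * r) / (2 * sqrt r)\<close>.\<close>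
  define N where "N = M0 * M * (3 + 2 * y0)"
  \<comment> \<open>The constant of \<open>degenerate_phase_estimate\<close> for
    \<open>\<kappa> = lam\<close>.\<close>
  define c where "c = 8 / lam + 6 * 2 powr (\<alpha> + 2) / lam + 36 * 2 powr ((\<alpha> - 1) / 2) / sqrt lam"
  have c: "0 \<le> c" using lam by (simp add: c_def)
  have N: "0 \<le> N" using M M0_nonneg y0 by (simp add: N_def)
  define C where "C = (M0 * M + 2 * (c * N)) * sqrt (2 / lam) + 1"
  have C: "0 < C" "(M0 * M + 2 * (c * N)) * sqrt (2 / lam) \<le> C"
    using M M0_nonneg c N lam unfolding C_def by (auto intro!: add_nonneg_pos mult_nonneg_nonneg)
  have "cmod (J \<tau> K) \<le> C * \<bar>\<tau>\<bar> powr (- exponent)" if \<tau>: "1 \<le> \<bar>\<tau>\<bar>" and K: "lam * \<bar>\<tau>\<bar> / 2 \<le> K" for \<tau> K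
  proof -
    define T where "T = \<bar>\<tau>\<bar>"
    have T: "1 \<le> T" "0 < T" "\<tau> \<noteq> 0" using \<tau> by (auto simp: T_def)
    define \<rho> where "\<rho> = T powr (- 1 / (2 + \<alpha>))"
    have \<rho>: "0 < \<rho>" using T by (simp add: \<rho>_def)
    \<comment> \<open>With \<open>L = lam * T\<close> this choice of \<open>\<rho>\<close> makes
      \<open>\<kappa>\<close> equal to \<open>lam\<close>, so the constant does not depend on
      \<open>\<tau>\<close>.\<close>
    have \<rho>\<alpha>: "lam * T * \<rho> powr (\<alpha> + 2) = lam"
    proof -
      have "- 1 / (2 + \<alpha>) * (\<alpha> + 2) = -1" using alpha by (simp add: field_simps)
      then have "\<rho> powr (\<alpha> + 2) = T powr -1" by (simp only: \<rho>_def powr_powr)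
      then show ?thesis using T by (simp add: powr_minus)
    qed
    have K0: "0 < K" using K lam T by (smt (verit) T_def divide_pos_pos mult_pos_pos)
    \<comment> \<open>Because \<open>T * \<rho> \<ge> 1\<close>, the argument \<open>K * r\<close>
      stays above \<open>lam / 2\<close> for all \<open>r \<ge> \<rho>\<close>; this is the
      threshold from which the amplitude bounds were requested.\<close>
    have K\<rho>: "lam / 2 \<le> K * \<rho>"
    proof -
      have "1 \<le> T powr (1 + - 1 / (2 + \<alpha>))"
        using T alpha by (intro ge_one_powr_ge_zero) (auto simp: field_simps)
      also have "\<dots> = T * \<rho>" unfolding powr_add \<rho>_def using T by simp
      finally have "lam / 2 * 1 \<le> lam / 2 * (T * \<rho>)" using lam by (intro mult_left_mono) auto
      also have "\<dots> = lam * \<bar>\<tau>\<bar> / 2 * \<rho>" by (simp add: T_def)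
      also have "\<dots> \<le> K * \<rho>" using K \<rho> by (intro mult_right_mono) auto
      finally show ?thesis by simp
    qed
    define F where "F r = of_real r * (exp (\<i> * of_real (\<tau> * g r)) * chi r) * circle_wave (K * r)" for r
    \<comment> \<open>If \<open>\<rho>\<close> exceeds \<open>y0\<close>, the far part is a single
      point and the near bound covers the whole interval.\<close>
    define m where "m = min \<rho> y0"
    have m: "0 \<le> m" "m \<le> \<rho>" "m \<le> y0" using \<rho> y0 by (auto simp: m_def)
    have cF: "continuous_on {0..y0} F" unfolding F_def by (rule cont_J)
    have near: "cmod (integral {0..m} F) \<le> M0 * M / sqrt K * \<rho> powr (3 / 2)"
    proof -
      have "cmod (integral {0..m} F) \<le> M0 * M / sqrt K * sqrt \<rho> * (m - 0)"
      proof (rule integral_bound)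
        show "continuous_on {0..m} F" by (rule continuous_on_subset[OF cF]) (use m in auto)
        fix r assume r: "r \<in> {0..m}"
        show "cmod (F r) \<le> M0 * M / sqrt K * sqrt \<rho>"
        proof (cases "r = 0")
          case True then show ?thesis using M0_nonneg M K0 \<rho> by (simp add: F_def)
        next
          case False
          with r have r0: "0 < r" by auto
          have "cmod (F r) = r * (cmod (chi r) * cmod (circle_wave (K * r)))"
            using r0 by (simp add: F_def norm_mult mult.assoc del: of_real_mult)
          also have "\<dots> \<le> r * (M0 * (M / sqrt (K * r)))"
            using r r0 m M0_nonneg K0 M by (intro mult_left_mono mult_mono chi_le cw) auto
          also have "\<dots> = M0 * M / sqrt K * sqrt r"
          proof -
            have "r / sqrt (K * r) = (r / sqrt r) / sqrt K" by (simp add: real_sqrt_mult mult.commute)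
            also have "r / sqrt r = sqrt r" using r0 by (simp add: real_div_sqrt)
            finally have "r / sqrt (K * r) * (M0 * M) = sqrt r / sqrt K * (M0 * M)" by simp
            then show ?thesis by (simp add: mult_ac)
          qed
          also have "\<dots> \<le> M0 * M / sqrt K * sqrt \<rho>"
            using r m M0_nonneg M K0 by (intro mult_left_mono) auto
          finally show ?thesis .
        qed
      qed (rule m)
      also have "\<dots> \<le> M0 * M / sqrt K * sqrt \<rho> * \<rho>"
        using m M0_nonneg M K0 \<rho> by (intro mult_left_mono) auto
      also have "\<dots> = M0 * M / sqrt K * \<rho> powr (3 / 2)"
        using \<rho> powr_add[of \<rho> "1 / 2" 1] by (simp add: powr_half_sqrt)
      finally show ?thesis .
    qed
    have far: "cmod (integral {m..y0} F) \<le> 2 * (c * N) / sqrt K * \<rho> powr (3 / 2)"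
    proof (cases "\<rho> \<le> y0")
      case False
      then show ?thesis using c N K0 by (simp add: m_def)
    next
      case True
      then have [simp]: "m = \<rho>" by (simp add: m_def)
      define A where "A \<epsilon> r = of_real (sqrt r) * chi r * P \<epsilon> (K * r)" for \<epsilon> r
      define A' where "A' \<epsilon> r = of_real (sqrt r) * chi r * (K *\<^sub>R P' \<epsilon> (K * r))
          + (of_real (sqrt r) * chi' r + of_real (1 / (2 * sqrt r)) * chi r) * P \<epsilon> (K * r)" for \<epsilon> r
      \<comment> \<open>The two components contribute the phases \<open>\<tau> * g r + K * r\<close>
        and \<open>\<tau> * g r - K * r\<close>. They have the same second derivative, so the sign
        \<open>\<epsilon>\<close> can be carried as a parameter.\<close>
      define Z where "Z \<epsilon> r = exp (\<i> * of_real (\<tau> * g r + \<epsilon> * K * r)) * A \<epsilon> r" for \<epsilon> r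
      have dA: "(A \<epsilon> has_vector_derivative A' \<epsilon> r) (at r)" if \<epsilon>: "\<epsilon>\<^sup>2 = 1" and r: "0 < r" for \<epsilon> r
      proof -
        have "((\<lambda>r. P \<epsilon> (K * r)) has_vector_derivative K *\<^sub>R P' \<epsilon> (K * r)) (at r)"
          by (rule vector_diff_chain_at[of "\<lambda>r. K * r" K, unfolded o_def])
             (use K0 r in \<open>auto intro!: dP \<epsilon> derivative_eq_intros simp flip: has_real_derivative_iff_has_vector_derivative\<close>)
        moreover have "((\<lambda>s. complex_of_real (sqrt s)) has_vector_derivative of_real (1 / (2 * sqrt r))) (at r)"
          using r by (intro has_vector_derivative_of_real)
            (auto intro!: derivative_eq_intros simp: field_simps simp flip: has_real_derivative_iff_has_vector_derivative)
        ultimately show ?thesis unfolding A_def A'_def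
          by (intro has_vector_derivative_mult deriv_chi r)
      qed
      have cA: "continuous_on {\<rho>..y0} (A \<epsilon>)" if "\<epsilon>\<^sup>2 = 1" for \<epsilon>
        using \<rho> by (intro continuous_at_imp_continuous_on ballI has_vector_derivative_continuous[OF dA[OF that]]) auto
      have cZ: "continuous_on {\<rho>..y0} (Z \<epsilon>)" if "\<epsilon>\<^sup>2 = 1" for \<epsilon>
        unfolding Z_def using \<rho> by (intro continuous_intros cA that continuous_on_subset[OF cont_g]) auto
      have Z_le: "cmod (integral {\<rho>..y0} (Z \<epsilon>)) \<le> c * N * \<rho> powr (3 / 2)" if \<epsilon>: "\<epsilon>\<^sup>2 = 1" for \<epsilon>
        unfolding Z_def c_def
      proof (rule degenerate_phase_estimate[where s = "\<sigma> * sgn \<tau>" and f' = "\<lambda>r. \<tau> * g' r + \<epsilon> * K" and f'' = "\<lambda>r. \<tau> * g'' r"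
          and L = "lam * T" and A' = "A' \<epsilon>"])
        show "continuous_on {\<rho>..y0} (\<lambda>r. \<tau> * g r + \<epsilon> * K * r)"
          using \<rho> by (intro continuous_intros continuous_on_subset[OF cont_g]) auto
        show "continuous_on {\<rho>..y0} (\<lambda>r. \<tau> * g' r + \<epsilon> * K)"
          using \<rho> by (intro continuous_intros continuous_on_subset[OF cont_g']) auto
        show "continuous_on {\<rho>..y0} (A \<epsilon>)" by (rule cA[OF \<epsilon>])
        show "\<sigma> * sgn \<tau> = 1 \<or> \<sigma> * sgn \<tau> = -1" using phase_sign(1) T by simp
        fix r assume r: "\<rho> < r" "r < y0"
        then have r0: "0 < r" using \<rho> by simp
        show "((\<lambda>r. \<tau> * g r + \<epsilon> * K * r) has_real_derivative \<tau> * g' r + \<epsilon> * K) (at r)"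
          "((\<lambda>r. \<tau> * g' r + \<epsilon> * K) has_real_derivative \<tau> * g'' r) (at r)"
          by (rule phase_derivs[OF r0])+
        show "lam * T * r powr \<alpha> \<le> \<sigma> * sgn \<tau> * (\<tau> * g'' r)"
          unfolding T_def using r r0 T by (intro phase_sign(2)) auto
        show "(A \<epsilon> has_vector_derivative A' \<epsilon> r) (at r)" by (rule dA[OF \<epsilon> r0])
        have Kr: "lam / 2 \<le> K * r" using r K0 by (intro order_trans[OF K\<rho>] mult_left_mono) auto
        have "cmod (A' \<epsilon> r) \<le> cmod (of_real (sqrt r) * chi r * (K *\<^sub>R P' \<epsilon> (K * r)))
            + (cmod (of_real (sqrt r) * chi' r) + cmod (of_real (1 / (2 * sqrt r)) * chi r)) * cmod (P \<epsilon> (K * r))"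
          unfolding A'_def
          by (intro order_trans[OF norm_triangle_ineq] add_mono order_refl)
             (unfold norm_mult[of _ "P \<epsilon> (K * r)"], intro mult_right_mono norm_triangle_ineq norm_ge_zero)
        also have "\<dots> = sqrt r * cmod (chi r) * (K * cmod (P' \<epsilon> (K * r)))
            + (sqrt r * cmod (chi' r) + 1 / (2 * sqrt r) * cmod (chi r)) * cmod (P \<epsilon> (K * r))"
          unfolding norm_mult norm_of_real norm_scaleR using r0 K0 by simp
        also have "\<dots> \<le> sqrt r * M0 * (K * (M / (K * r))) + (sqrt r * M0 + 1 / (2 * sqrt r) * M0) * M"
          using r r0 \<rho> K0 M0_nonneg M Kr \<epsilon>
          by (intro add_mono mult_mono mult_left_mono chi_le chi'_le P_le) auto
        also have "\<dots> = M0 * M * (3 + 2 * r) / (2 * sqrt r)"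
        proof -
          define q where "q = sqrt r"
          have q: "0 < q" "r = q\<^sup>2" using r0 by (auto simp: q_def)
          show ?thesis unfolding q_def[symmetric] q(2) using q(1) K0
            by (simp add: field_simps power2_eq_square)
        qed
        also have "\<dots> \<le> N / (2 * sqrt r)"
          unfolding N_def using r r0 M0_nonneg M by (intro divide_right_mono mult_left_mono) auto
        finally show "cmod (A' \<epsilon> r) \<le> N / (2 * sqrt r)" .
      next
        fix r assume r: "\<rho> \<le> r" "r \<le> y0"
        then have r0: "0 < r" using \<rho> by simp
        have Kr: "lam / 2 \<le> K * r" using r K0 by (intro order_trans[OF K\<rho>] mult_left_mono) auto
        have "cmod (A \<epsilon> r) \<le> sqrt r * M0 * M"
          unfolding A_def norm_mult norm_of_real using r r0 M0_nonneg Kr \<epsilon>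
          by (intro mult_mono chi_le P_le) auto
        also have "\<dots> = M0 * M * 1 * sqrt r" by simp
        also have "\<dots> \<le> M0 * M * (3 + 2 * y0) * sqrt r"
          using M0_nonneg M y0 r0 by (intro mult_right_mono mult_left_mono) auto
        finally show "cmod (A \<epsilon> r) \<le> N * sqrt r" by (simp add: N_def)
      qed (use alpha \<rho> True lam T \<rho>\<alpha> in auto)
      have "integral {\<rho>..y0} F = integral {\<rho>..y0} (\<lambda>r. of_real (1 / sqrt K) * (Z 1 r + Z (-1) r))"
      proof (rule integral_cong)
        fix r assume "r \<in> {\<rho>..y0}"
        then have r0: "0 < r" using \<rho> by simp
        \<comment> \<open>Splitting the polar weight: \<open>sqrt (K * r)\<close> normalizes the
          circle integral, \<open>sqrt r\<close> stays in the amplitude \<open>A\<close>, and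
          \<open>1 / sqrt K\<close> is the gain.\<close>
        have "r = 1 / sqrt K * sqrt r * sqrt (K * r)"
          using r0 K0 by (simp add: real_sqrt_mult)
        then have "complex_of_real r = of_real (1 / sqrt K * sqrt r * sqrt (K * r))" by (rule arg_cong)
        then have "complex_of_real r = of_real (1 / sqrt K) * of_real (sqrt r) * of_real (sqrt (K * r))"
          by (simp only: of_real_mult)
        then have "F r = of_real (1 / sqrt K) * of_real (sqrt r) * (exp (\<i> * of_real (\<tau> * g r)) * chi r) * (of_real (sqrt (K * r)) * circle_wave (K * r))"
          unfolding F_def by (simp only: mult_ac)
        also have "of_real (sqrt (K * r)) * circle_wave (K * r)
           = exp (\<i> * of_real (K * r)) * P 1 (K * r) + exp (- \<i> * of_real (K * r)) * P (-1) (K * r)"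
          using K0 r0 by (intro cw) simp
        also have "of_real (1 / sqrt K) * of_real (sqrt r) * (exp (\<i> * of_real (\<tau> * g r)) * chi r) * \<dots>
           = of_real (1 / sqrt K) * (Z 1 r + Z (-1) r)"
        proof -
          have "exp (\<i> * of_real (\<tau> * g r + 1 * K * r)) = exp (\<i> * of_real (\<tau> * g r)) * exp (\<i> * of_real (K * r))"
            by (simp add: distrib_left flip: exp_add)
          moreover have "exp (\<i> * of_real (\<tau> * g r + (-1) * K * r)) = exp (\<i> * of_real (\<tau> * g r)) * exp (- \<i> * of_real (K * r))"
            by (simp add: right_diff_distrib flip: exp_add)
          ultimately show ?thesis unfolding Z_def A_def by (simp only: ring_distribs mult_ac)
        qed
        finally show "F r = of_real (1 / sqrt K) * (Z 1 r + Z (-1) r)" .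
      qed
      also have "\<dots> = of_real (1 / sqrt K) * (integral {\<rho>..y0} (Z 1) + integral {\<rho>..y0} (Z (-1)))"
        by (subst integral_mult_right, subst integral_add) (auto intro!: integrable_continuous_real cZ)
      finally have "cmod (integral {m..y0} F) = 1 / sqrt K * cmod (integral {\<rho>..y0} (Z 1) + integral {\<rho>..y0} (Z (-1)))"
        using K0 by (simp add: norm_mult norm_divide)
      also have "\<dots> \<le> 1 / sqrt K * (c * N * \<rho> powr (3 / 2) + c * N * \<rho> powr (3 / 2))"
        using K0 Z_le[of 1] Z_le[of "-1"] by (intro mult_left_mono order_trans[OF norm_triangle_ineq] add_mono) auto
      also have "\<dots> = 2 * (c * N) / sqrt K * \<rho> powr (3 / 2)" by simp
      finally show ?thesis by simp
    qed
    have "J \<tau> K = integral {0..m} F + integral {m..y0} F"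
      unfolding J_def F_def[symmetric]
      by (rule Henstock_Kurzweil_Integration.integral_combine[symmetric])
         (use m integrable_continuous_real[OF cF] in auto)
    then have "cmod (J \<tau> K) \<le> M0 * M / sqrt K * \<rho> powr (3 / 2) + 2 * (c * N) / sqrt K * \<rho> powr (3 / 2)"
      using near far norm_triangle_ineq[of "integral {0..m} F" "integral {m..y0} F"] by simp
    also have "\<dots> = (M0 * M + 2 * (c * N)) * \<rho> powr (3 / 2) * (1 / sqrt K)"
      by (simp add: add_divide_distrib distrib_right)
    also have "\<dots> \<le> (M0 * M + 2 * (c * N)) * \<rho> powr (3 / 2) * (sqrt (2 / lam) * T powr (- 1 / 2))"
    proof (rule mult_left_mono)
      have "1 / sqrt K \<le> 1 / sqrt (lam * T / 2)"
        using K K0 lam T by (intro divide_left_mono) (auto simp: T_def)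
      also have "\<dots> = sqrt (2 / lam) * T powr (- 1 / 2)"
        using lam T by (simp add: real_sqrt_mult real_sqrt_divide powr_minus powr_half_sqrt field_simps)
      finally show "1 / sqrt K \<le> sqrt (2 / lam) * T powr (- 1 / 2)" .
    qed (use M0_nonneg M c N in \<open>auto intro!: mult_nonneg_nonneg add_nonneg_nonneg\<close>)
    also have "\<dots> = (M0 * M + 2 * (c * N)) * sqrt (2 / lam) * (\<rho> powr (3 / 2) * T powr (- 1 / 2))" by simp
    also have "\<rho> powr (3 / 2) * T powr (- 1 / 2) = T powr (- exponent)"
    proof -
      have "- 1 / (2 + \<alpha>) * (3 / 2) + - 1 / 2 = - exponent"
        unfolding exponent_def using alpha by (simp add: field_simps)
      then show ?thesis by (simp only: \<rho>_def powr_powr powr_add[symmetric])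
    qed
    also have "(M0 * M + 2 * (c * N)) * sqrt (2 / lam) * T powr (- exponent) \<le> C * T powr (- exponent)"
      by (rule mult_right_mono[OF C(2)]) simp
    finally show ?thesis by (simp add: T_def)
  qed
  then show ?thesis using that C(1) by blast
qed

text \<open>Three regimes: |\<tau>| < 1 by the trivial bound, and |\<tau>| \<ge> 1 with
  \<open>K\<close> below or above \<open>lam * \<bar>\<tau>\<bar> / 2\<close>. Adding the constants
  covers all of them.\<close>

lemma J_decay:
  obtains C where "0 < C"
    "\<And>\<tau> K. \<tau> \<noteq> 0 \<Longrightarrow> 0 \<le> K \<Longrightarrow> cmod (J \<tau> K) \<le> C * \<bar>\<tau>\<bar> powr (- exponent)"
proof -
  obtain C1 where C1: "0 < C1"
    "\<And>\<tau> K. 1 \<le> \<bar>\<tau>\<bar> \<Longrightarrow> lam * \<bar>\<tau>\<bar> / 2 \<le> K \<Longrightarrow> cmod (J \<tau> K) \<le> C1 * \<bar>\<tau>\<bar> powr (- exponent)"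
    by (rule J_high_frequency) blast
  define C2 where "C2 = 16 * pi * M0 * (1 + y0) * y0 / lam"
  define C3 where "C3 = 2 * pi * M0 * y0\<^sup>2"
  have C: "0 \<le> C2" "0 \<le> C3" using M0_nonneg y0 lam by (auto simp: C2_def C3_def)
  show ?thesis
  proof (rule that[of "C1 + C2 + C3"])
    show "0 < C1 + C2 + C3" using C C1 by simp
    fix \<tau> K :: real assume \<tau>: "\<tau> \<noteq> 0" and K: "0 \<le> K"
    let ?p = "\<bar>\<tau>\<bar> powr (- exponent)"
    have "cmod (J \<tau> K) \<le> C1 * ?p \<or> cmod (J \<tau> K) \<le> C2 * ?p \<or> cmod (J \<tau> K) \<le> C3 * ?p"
    proof (cases "1 \<le> \<bar>\<tau>\<bar>")
      case True
      show ?thesis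
      proof (cases "K \<le> lam * \<bar>\<tau>\<bar> / 2")
        case low: True
        have "1 / \<bar>\<tau>\<bar> = \<bar>\<tau>\<bar> powr -1" using \<tau> by (simp add: powr_minus_divide)
        also have "\<dots> \<le> ?p" using exponent_bounds True by (intro powr_mono) auto
        finally have "C2 * (1 / \<bar>\<tau>\<bar>) \<le> C2 * ?p" using C by (intro mult_left_mono) auto
        then show ?thesis using J_low_frequency[OF \<tau> K low] by (simp add: C2_def)
      next
        case False
        then show ?thesis using C1(2)[OF True, of K] by simp
      qed
    next
      case False
      have "\<bar>\<tau>\<bar> powr 0 \<le> ?p" using exponent_bounds False \<tau> by (intro powr_mono') auto
      then have "C3 * 1 \<le> C3 * ?p" using C \<tau> by (intro mult_left_mono) auto
      moreover have "cmod (J \<tau> K) \<le> C3" unfolding C3_def by (rule J_trivial)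
      ultimately show ?thesis by linarith
    qed
    moreover have "C1 * ?p \<le> (C1 + C2 + C3) * ?p" "C2 * ?p \<le> (C1 + C2 + C3) * ?p" "C3 * ?p \<le> (C1 + C2 + C3) * ?p"
      using C C1 by (auto intro!: mult_right_mono)
    ultimately show "cmod (J \<tau> K) \<le> (C1 + C2 + C3) * ?p" by linarith
  qed
qed

end

section \<open>Rescaling and the final estimate\<close>

lemma osc_integral_radial:
  assumes g: "continuous_on {0..} g" and chi: "continuous_on {0..} chi"
    and y0: "0 < y0" "\<And>y. y0 \<le> y \<Longrightarrow> chi y = 0" and \<delta>: "0 < \<delta>"
  shows "osc_integral g chi t \<delta> x
    = (1 / \<delta>\<^sup>2) *\<^sub>R integral {0..y0} (\<lambda>r. of_real r * (exp (\<i> * of_real (t / \<delta> * g r)) * chi r) * circle_wave (norm x / \<delta> * r))"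
proof -
  define F where "F r = exp (\<i> * of_real (t / \<delta> * g (\<delta> * r))) * chi (\<delta> * r)" for r
  define G where "G r = of_real r * (exp (\<i> * of_real (t / \<delta> * g r)) * chi r) * circle_wave (norm x / \<delta> * r)" for r
  have "osc_integral g chi t \<delta> x = (LINT \<xi>|lborel. exp (\<i> * of_real (x \<bullet> \<xi>)) * F (norm \<xi>))"
    by (simp add: osc_integral_def F_def mult.assoc)
  also have "\<dots> = integral {0..y0 / \<delta>} (\<lambda>r. of_real r * F r * circle_wave (norm x * r))"
  proof (rule integral_plane_wave_radial)
    show "continuous_on {0..} F" unfolding F_def
      by (intro continuous_intros continuous_on_compose2[OF g] continuous_on_compose2[OF chi]) (use \<delta> in auto)
    show "F r = 0" if "y0 / \<delta> \<le> r" for r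
      using that y0 \<delta> by (simp add: F_def field_simps)
  qed (use y0 \<delta> in auto)
  also have "\<dots> = integral {0..y0 / \<delta>} (\<lambda>r. (1 / \<delta>) *\<^sub>R G (\<delta> * r))"
    using \<delta> by (simp add: F_def G_def scaleR_conv_of_real mult.assoc)
  also have "\<dots> = (1 / \<delta>) *\<^sub>R integral {0..y0 / \<delta>} (\<lambda>r. G (\<delta> * r))" by simp
  \<comment> \<open>This substitution supplies the second factor 1 / \<delta>; the first came from
    writing the polar weight \<open>r\<close> as \<open>\<delta> * r\<close> divided by
    \<open>\<delta>\<close>.\<close>
  also have "integral {0..y0 / \<delta>} (\<lambda>r. G (\<delta> * r)) = (1 / \<delta>) *\<^sub>R integral {0..y0} G"
  proof -
    have "G integrable_on {0..y0}" unfolding G_def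
      by (intro integrable_continuous_real continuous_intros continuous_on_subset[OF g] continuous_on_subset[OF chi]
        continuous_on_compose2[OF circle_wave_continuous]) (use \<delta> in auto)
    then have "(G has_integral integral {0..y0} G) (cbox 0 y0)" by (simp add: integrable_integral)
    from has_integral_affinity[OF this, of \<delta> 0]
    have "((\<lambda>r. G (\<delta> * r)) has_integral (1 / \<delta>) *\<^sub>R integral {0..y0} G) ((\<lambda>x. x / \<delta>) ` {0..y0})"
      using \<delta> by (simp add: divide_inverse mult.commute)
    moreover have "(\<lambda>x. x / \<delta>) ` {0..y0} = {0..y0 / \<delta>}"
      using \<delta> y0 by (simp add: image_divide_atLeastAtMost)
    ultimately show ?thesis by (simp add: integral_unique)
  qed
  finally show ?thesis by (simp add: G_def[abs_def] power2_eq_square)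
qed

text \<open>By the intermediate value theorem. Applied to \<open>g''\<close>, it turns the bound on
  the absolute value into the signed curvature bound on which integration by parts relies.\<close>

lemma constant_sign:
  fixes h :: "real \<Rightarrow> real"
  assumes S: "connected S" and h: "continuous_on S h" and nz: "\<And>y. y \<in> S \<Longrightarrow> h y \<noteq> 0"
  obtains \<sigma> where "\<sigma> = 1 \<or> \<sigma> = (-1::real)" "\<And>y. y \<in> S \<Longrightarrow> \<sigma> * h y = \<bar>h y\<bar>"
proof -
  have "connected (h ` S)" by (rule connected_continuous_image[OF h S])
  then have iv: "0 \<in> h ` S" if "a \<in> h ` S" "b \<in> h ` S" "a \<le> 0" "0 \<le> b" for a b
    using that unfolding connected_iff_interval by blast
  show ?thesis
  proof (cases "\<exists>a\<in>S. h a < 0")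
    case True
    then obtain a where a: "a \<in> S" "h a < 0" by blast
    then have "h y < 0" if "y \<in> S" for y
      using iv[of "h a" "h y"] nz that by (metis imageE imageI linorder_not_le less_le)
    then show ?thesis by (intro that[of "-1"]) (auto simp: abs_of_neg)
  next
    case False
    then show ?thesis by (intro that[of 1]) (auto simp: abs_of_nonneg not_less)
  qed
qed

theorem lemma2p12:
  fixes \<alpha> \<Lambda> lam y\<^sub>0 :: real
    and g g' g'' :: "real \<Rightarrow> real"
    and chi :: "real \<Rightarrow> complex"
  assumes alpha: "\<alpha> \<ge> 1"
    and pos: "\<Lambda> > 0" "lam > 0" "y\<^sub>0 > 0"
    and g_C2: "\<And>y. y > 0 \<Longrightarrow> (g has_real_derivative g' y) (at y)"
              "\<And>y. y > 0 \<Longrightarrow> (g' has_real_derivative g'' y) (at y)"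
              "continuous_on {0<..} g''"
    and g_C1: "\<exists>\<epsilon>>0. (\<forall>y\<in>{0..<\<epsilon>}. (g has_real_derivative g' y) (at y within {0..}))
                     \<and> continuous_on {0..<\<epsilon>} g'"
    and g'_lower: "\<And>y. y \<in> {0..y\<^sub>0} \<Longrightarrow> \<bar>g' y\<bar> \<ge> lam"
    and g''_lower: "\<And>y. y \<in> {0<..y\<^sub>0} \<Longrightarrow> \<bar>g'' y\<bar> \<ge> lam * y powr \<alpha>"
    and alpha_1: "\<alpha> = 1 \<Longrightarrow> (\<forall>y\<in>{0..y\<^sub>0}. lam * y powr (\<alpha> + 1) \<le> \<bar>g' y - g' 0\<bar>
                                 \<and> \<bar>g' y - g' 0\<bar> \<le> \<Lambda> * y powr (\<alpha> + 1))"
    and chi_smooth: "smooth_on {0..} chi"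
    and chi_supp: "\<And>y. y \<ge> y\<^sub>0 \<Longrightarrow> chi y = 0"
  shows "\<exists>C>0. \<forall>t \<delta>. t \<noteq> 0 \<and> \<delta> > 0 \<longrightarrow>
           (SUP x. ereal (cmod (osc_integral g chi t \<delta> x)))
             \<le> ereal (C * (\<delta> powr (- (3 / 2) * ((1 + \<alpha>) / (2 + \<alpha>)))
                        / \<bar>t\<bar> powr ((5 + \<alpha>) / (2 * (2 + \<alpha>)))))"
proof -
  obtain \<epsilon> where \<epsilon>: "0 < \<epsilon>" "\<And>y. y \<in> {0..<\<epsilon>} \<Longrightarrow> (g has_real_derivative g' y) (at y within {0..})"
    "continuous_on {0..<\<epsilon>} g'" using g_C1 by blast
  have cont_g: "continuous_on {0..} g"
    unfolding continuous_on_eq_continuous_within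
  proof
    fix y :: real assume "y \<in> {0..}"
    then consider "y \<in> {0..<\<epsilon>}" | "0 < y" using \<epsilon>(1) by fastforce
    then show "continuous (at y within {0..}) g"
      by cases (use \<epsilon>(2) g_C2(1) in \<open>auto intro: DERIV_continuous has_field_derivative_at_within\<close>)
  qed
  \<comment> \<open>The half-line is the union of \<open>{0..<\<epsilon>}\<close> and
    \<open>{0<..}\<close>, both relatively open in it, so continuity on the two pieces
    glues.\<close>
  have cont_g': "continuous_on {0..} g'"
  proof -
    have cpos: "continuous_on {0<..} g'"
      by (intro continuous_at_imp_continuous_on ballI DERIV_isCont[OF g_C2(2)]) auto
    have un: "{0..} = {0..<\<epsilon>} \<union> {0<..}" using \<epsilon>(1) by auto
    have "{0..<\<epsilon>} = {0..} \<inter> {..<\<epsilon>}" by auto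
    then have "openin (top_of_set {0..}) {0..<\<epsilon>}" by (metis openin_open_Int open_lessThan)
    moreover have "{0<..} = {0..} \<inter> {0::real<..}" by auto
    then have "openin (top_of_set {0..}) {0::real<..}" by (metis openin_open_Int open_greaterThan)
    ultimately show ?thesis unfolding un
      by (intro continuous_on_Un_local_open \<epsilon>(3) cpos) (simp_all add: un)
  qed
  obtain \<sigma> where \<sigma>: "\<sigma> = 1 \<or> \<sigma> = -1" "\<And>y. y \<in> {0<..y\<^sub>0} \<Longrightarrow> \<sigma> * g'' y = \<bar>g'' y\<bar>"
  proof (rule constant_sign[of "{0<..y\<^sub>0}" g''])
    show "g'' y \<noteq> 0" if "y \<in> {0<..y\<^sub>0}" for y
      using g''_lower[OF that] that pos by (smt (verit) greaterThanAtMost_iff mult_pos_pos powr_gt_zero)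
  qed (auto intro: continuous_on_subset[OF g_C2(3)])
  obtain D where D: "D 0 = chi"
    "\<And>k y. 0 \<le> y \<Longrightarrow> (D k has_vector_derivative D (Suc k) y) (at y within {0..})"
    using chi_smooth unfolding smooth_on_def by auto
  have contD: "continuous_on {0..} (D k)" for k
    by (rule continuous_on_vector_derivative) (rule D(2), simp)
  have bddD: "\<exists>B. \<forall>y\<in>{0..y\<^sub>0}. cmod (D k y) \<le> B" for k
  proof -
    have "compact (D k ` {0..y\<^sub>0})"
      by (intro compact_continuous_image continuous_on_subset[OF contD]) auto
    then have "bounded (D k ` {0..y\<^sub>0})" by (rule compact_imp_bounded)
    then show ?thesis by (auto simp: bounded_iff)
  qed
  obtain B0 B1 where B: "\<And>y. y \<in> {0..y\<^sub>0} \<Longrightarrow> cmod (D 0 y) \<le> B0" "\<And>y. y \<in> {0..y\<^sub>0} \<Longrightarrow> cmod (D 1 y) \<le> B1"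
    using bddD[of 0] bddD[of 1] by blast
  interpret radial_phase \<alpha> lam y\<^sub>0 "max B0 B1" \<sigma> g g' g'' chi "D 1"
  proof
    show "lam * y powr \<alpha> \<le> \<sigma> * g'' y" if "0 < y" "y \<le> y\<^sub>0" for y
      using g''_lower[of y] \<sigma>(2)[of y] that by simp
    show "(chi has_vector_derivative D 1 y) (at y)" if "0 < y" for y
    proof -
      have "(D 0 has_vector_derivative D (Suc 0) y) (at y within {0..})" using that by (intro D(2)) simp
      moreover have "at y within {0..} = at y" using that by (intro at_within_interior) simp
      ultimately show ?thesis by (simp only: D(1) One_nat_def)
    qed
    show "continuous_on {0..} chi" using contD[of 0] by (simp add: D(1))
    show "cmod (chi y) \<le> max B0 B1" "cmod (D 1 y) \<le> max B0 B1" if "0 \<le> y" "y \<le> y\<^sub>0" for y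
      using B(1)[of y] B(2)[of y] that unfolding D(1) by (simp_all add: le_max_iff_disj)
  qed (use alpha pos g_C2 cont_g cont_g' g'_lower \<sigma>(1) in auto)
  obtain C where C: "0 < C" "\<And>\<tau> K. \<tau> \<noteq> 0 \<Longrightarrow> 0 \<le> K \<Longrightarrow> cmod (J \<tau> K) \<le> C * \<bar>\<tau>\<bar> powr (- exponent)"
    by (rule J_decay) blast
  have "cmod (osc_integral g chi t \<delta> x) \<le> C * (\<delta> powr (- (3 / 2) * ((1 + \<alpha>) / (2 + \<alpha>))) / \<bar>t\<bar> powr ((5 + \<alpha>) / (2 * (2 + \<alpha>))))"
    if t: "t \<noteq> 0" and \<delta>: "0 < \<delta>" for t \<delta> x
  proof -
    have "osc_integral g chi t \<delta> x = (1 / \<delta>\<^sup>2) *\<^sub>R J (t / \<delta>) (norm x / \<delta>)"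
      unfolding J_def by (rule osc_integral_radial[OF cont_g cont_chi pos(3) chi_supp \<delta>])
    then have "cmod (osc_integral g chi t \<delta> x) = 1 / \<delta>\<^sup>2 * cmod (J (t / \<delta>) (norm x / \<delta>))" by simp
    also have "\<dots> \<le> 1 / \<delta>\<^sup>2 * (C * \<bar>t / \<delta>\<bar> powr (- exponent))"
      using t \<delta> by (intro mult_left_mono C) auto
    \<comment> \<open>The rescaling contributes \<delta>^(-2), and the decay in
      \<open>t / \<delta>\<close> gives back \<open>\<delta> powr exponent\<close>.\<close>
    also have "\<dots> = C * (\<delta> powr (exponent - 2) / \<bar>t\<bar> powr exponent)"
      using \<delta> by (simp add: powr_divide powr_minus powr_diff field_simps)
    also have "exponent - 2 = - (3 / 2) * ((1 + \<alpha>) / (2 + \<alpha>))"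
      unfolding exponent_def using alpha by (simp add: field_simps)
    finally show ?thesis by (simp add: exponent_def)
  qed
  then show ?thesis using C(1) by (intro exI[of _ C]) (auto intro!: SUP_least)
qed

end
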